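(* For all integers $n>0$ and $m\ge 2$ and every partition $\lambda\vdash n$, all the roots of the polynomial $\Gamma^{(m)}_{n,\lambda}(x)$ are real and non-positive.
   Context: Here $\mathbb{S}_n$ is the symmetric group on $n$ letters. For a partition $\lambda\vdash n$, $\ell(\lambda)$ is its number of parts and $C(\lambda)\subset\mathbb{S}_n$ is the conjugacy class of permutations of cycle type $\lambda$. For $\sigma\in\mathbb{S}_n$, $\mathrm{cyc}(\sigma)$ is its number of cycles. For $m\ge 2$, $\mathcal{M}_m(n,\lambda)$ is the set of tuples $(\phi,\sigma_0,\ldots,\sigma_{m-1})$ of permutations in $\mathbb{S}_n$ with $\phi\sigma_0\sigma_1\cdots\sigma_{m-1}=\mathrm{id}_n$, $\phi\in C(\lambda)$ and $\sigma_0$ an $n$-cycle. The genus of such a tuple is \[ g(\phi,\sigma_0,\ldots,\sigma_{m-1})=1+\tfrac12\Big((m-1)n-\ell(\lambda)-\sum_{i=0}^{m-1}\mathrm{cyc}(\sigma_i)\Big) \] (a non-negative integer), and $\Gamma^{(m)}_{n,\lambda}(x)=\sum_{M\in\mathcal{M}_m(n,\lambda)}x^{g(M)}$. *)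

theory Defs
  imports Complex_Main
    "HOL-Library.Multiset"
    "HOL-Combinatorics.Orbits"
    "HOL-Computational_Algebra.Polynomial"
begin

text \<open>
  The symmetric group on \<open>n\<close> letters is \<open>{\<sigma>. \<sigma> permutes {1..n}}\<close>, with composition of
  functions as multiplication (the rightmost factor acts first).
\<close>

text \<open>Partitions of \<open>n\<close> are multisets of positive parts; the number of parts is \<open>size\<close>.\<close>

definition is_partition :: "nat multiset \<Rightarrow> nat \<Rightarrow> bool"  (infix \<open>\<turnstile>\<close> 50) where
  "\<mu> \<turnstile> n \<longleftrightarrow> 0 \<notin># \<mu> \<and> sum_mset \<mu> = n"

text \<open>The supports of the cycles; fixed points count as cycles of length 1.\<close>

definition cycles :: "nat \<Rightarrow> (nat \<Rightarrow> nat) \<Rightarrow> nat set set" where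
  "cycles n \<sigma> = orbit \<sigma> ` {1..n}"

definition cyc :: "nat \<Rightarrow> (nat \<Rightarrow> nat) \<Rightarrow> nat" where
  "cyc n \<sigma> = card (cycles n \<sigma>)"

definition cycle_type :: "nat \<Rightarrow> (nat \<Rightarrow> nat) \<Rightarrow> nat multiset" where
  "cycle_type n \<sigma> = image_mset card (mset_set (cycles n \<sigma>))"

definition conj_class :: "nat \<Rightarrow> nat multiset \<Rightarrow> (nat \<Rightarrow> nat) set" where
  "conj_class n \<mu> = {\<sigma>. \<sigma> permutes {1..n} \<and> cycle_type n \<sigma> = \<mu>}"

text \<open>
  A tuple \<open>(\<phi>, \<sigma>\<^sub>0, \<dots>, \<sigma>\<^sub>m\<^sub>-\<^sub>1)\<close> is represented as \<open>(\<phi>, \<sigma>s)\<close> where \<open>\<sigma>s\<close> is a list of length \<open>m\<close>.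
\<close>

definition maps :: "nat \<Rightarrow> nat \<Rightarrow> nat multiset \<Rightarrow> ((nat \<Rightarrow> nat) \<times> (nat \<Rightarrow> nat) list) set" where
  "maps m n \<mu> = {(\<phi>, \<sigma>s).
     length \<sigma>s = m \<and> (\<forall>\<sigma>\<in>set \<sigma>s. \<sigma> permutes {1..n}) \<and>
     \<phi> \<circ> foldr (\<circ>) \<sigma>s id = id \<and>
     \<phi> \<in> conj_class n \<mu> \<and>
     cyclic_on (\<sigma>s ! 0) {1..n}}"

definition genus :: "nat \<Rightarrow> nat \<Rightarrow> nat multiset \<Rightarrow> (nat \<Rightarrow> nat) \<times> (nat \<Rightarrow> nat) list \<Rightarrow> real" where
  "genus m n \<mu> = (\<lambda>(\<phi>, \<sigma>s).
     1 + ((real m - 1) * real n - real (size \<mu>) - (\<Sum>i<m. real (cyc n (\<sigma>s ! i)))) / 2)"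

text \<open>
  The genus of an element of \<open>maps m n \<mu>\<close> is a non-negative integer (Riemann-Hurwitz), so the
  rounding in the exponent only changes its type.
\<close>

definition Gamma_poly :: "nat \<Rightarrow> nat \<Rightarrow> nat multiset \<Rightarrow> real poly" where
  "Gamma_poly m n \<mu> = (\<Sum>M\<in>maps m n \<mu>. monom 1 (nat \<lfloor>genus m n \<mu> M\<rfloor>))"

lemma finite_maps: "finite (maps m n \<mu>)"
proof -
  let ?S = "{\<sigma>. \<sigma> permutes {1..n}}"
  have "finite ?S" by (simp add: finite_permutations)
  then have "finite (?S \<times> {\<sigma>s. set \<sigma>s \<subseteq> ?S \<and> length \<sigma>s = m})"
    by (intro finite_cartesian_product finite_lists_length_eq)
  then show ?thesis
    by (rule finite_subset[rotated]) (auto simp: maps_def conj_class_def)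
qed

end

(*
  The sum of x^cyc(s) s over the symmetric group on n letters is central in the group algebra, and
  acts on the hook character with a leg of length k by the product
  H_k(x) = H_0(x - k) of the x + c over the contents c of the hook, where
  H_0(x) = x (x + 1) ... (x + n - 1).  Up to a scalar, the alternating sum of the hook characters is
  the indicator of the n-cycles, and their values on a permutation of type mu are, up to sign, the
  coefficients of g(t) = prod_l (1 - t^l) / (1 - t), the product running over the parts l of mu.
  Hence the sum over all maps of x^(cyc s_1 + ... + cyc s_(m-1)) is proportional to g(E) applied
  to H_0^(m-1), where E is the shift f(x) |-> f(x - 1).

  The zeros u of g lie on the unit circle, and each factor E - u moves the zeros that are not
  forced to a vertical line half a unit further to the right; at the end this line is the imaginary
  axis.  By Riemann-Hurwitz that sum is x^K Gamma(x^(-2)), so every non-zero root of Gamma is the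
  inverse square of a purely imaginary number.

  The hook characters are handled without representation theory: the trace of t on the k-th
  exterior power of the permutation representation is the sum of the signs of t on its stable
  k-subsets.
*)
theory Submission
  imports Defs "HOL-Computational_Algebra.Fundamental_Theorem_Algebra"
begin

section \<open>Counting cycles\<close>

text \<open>On the exterior algebra of the permutation representation let W be the wedge product
  with the sum of the basis vectors and D the contraction with the sum of the coordinates. Then D W
  + W D = n, and D W / n projects the k-th power onto the hook with a leg of length k. In the basis
  given by the k-subsets, W D = k + N and D W = n - k - N, where N exchanges one element of a subset
  for one outside it, in all possible ways. This is the origin of \<open>hook_char\<close>, and the
  relation between consecutive degrees is the equality of the traces of t D W in degree k and of t W
  D in degree k + 1. The proof itself only handles sums over subsets.

  For the zeros, the invariant is that after d factors of g the line is the axis of symmetry of the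
  surviving forced zeros 0, -1, ..., -(n-1-d). Hence the leftover forced zeros and the other zeros
  have one common bisector with respect to the next shift, and a single comparison of absolute
  values settles both. As g has degree n - 1, only the forced zero 0 survives all the steps.\<close>

definition ncyc :: "'a set \<Rightarrow> ('a \<Rightarrow> 'a) \<Rightarrow> nat" where
  "ncyc S p = card (orbit p ` S)"

lemma cyc_eq_ncyc: "cyc n p = ncyc {1..n} p"
  by (simp add: cyc_def cycles_def ncyc_def)

section \<open>Orbits under multiplication by a transposition\<close>

lemma orbit_eq_of_mem:
  assumes "permutation p" "y \<in> orbit p x"
  shows "orbit p y = orbit p x"
  using assms by (metis cyclic_on_orbit' orbit_cyclic_eq3)

lemma orbit_subset_invariant:
  assumes "x \<in> S" "p ` S \<subseteq> S"
  shows "orbit p x \<subseteq> S"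
proof
  fix y assume "y \<in> orbit p x"
  then show "y \<in> S" by induct (use assms in auto)
qed

text \<open>The product sends u to \<open>p v\<close>, then follows p around the orbit of v until it
  reaches v, and crosses from there to \<open>p u\<close>. One inclusion, \<open>half\<close>, is
  used twice with u and v exchanged.\<close>

lemma orbit_comp_transpose:
  assumes p: "permutation p" and v: "v \<notin> orbit p u"
  shows "orbit (p \<circ> transpose u v) u = orbit p u \<union> orbit p v"
    and "orbit (p \<circ> transpose u v) v = orbit p u \<union> orbit p v"
proof -
  have half: "orbit p v \<subseteq> orbit (p \<circ> transpose u v) u"
    if "v \<notin> orbit p u" for u v
  proof
    let ?q = "p \<circ> transpose u v"
    have u: "u \<notin> orbit p v"
      using that p by (metis orbit_eq_of_mem permutation_self_in_orbit)
    have pv: "p v \<in> orbit ?q u"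
      using orbit.base[of ?q u] by simp
    fix y assume "y \<in> orbit p v"
    then have "y \<in> orbit ?q u \<and> y \<in> orbit p v"
    proof induct
      case base
      show ?case using pv orbit.base by (rule conjI)
    next
      case (step y)
      then have "y \<noteq> u" using u by auto
      moreover have "p y \<in> orbit ?q u"
      proof (cases "y = v")
        case True
        then show ?thesis using pv by simp
      next
        case False
        then have "?q y = p y" using \<open>y \<noteq> u\<close> by (simp add: transpose_apply_other)
        then show ?thesis using step orbit.step[of y ?q u] by metis
      qed
      ultimately show ?case using step orbit.step[of y p v] by blast
    qed
    then show "y \<in> orbit ?q u" by simp
  qed
  let ?q = "p \<circ> transpose u v"
  have q: "permutation ?q"
    by (intro permutation_compose p permutation_swap_id)
  have u: "u \<notin> orbit p v"
    using v p by (metis orbit_eq_of_mem permutation_self_in_orbit)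
  have 1: "orbit p v \<subseteq> orbit ?q u" using half[OF v] .
  have 2: "orbit p u \<subseteq> orbit ?q v"
    using half[OF u] by (simp add: transpose_commute)
  have "v \<in> orbit ?q u" using 1 permutation_self_in_orbit[OF p] by auto
  then have 3: "orbit ?q v = orbit ?q u" by (rule orbit_eq_of_mem[OF q])
  have "?q ` (orbit p u \<union> orbit p v) \<subseteq> orbit p u \<union> orbit p v"
    by (auto simp: transpose_def intro: orbit.intros split: if_splits)
  then have "orbit ?q u \<subseteq> orbit p u \<union> orbit p v"
    by (intro orbit_subset_invariant) (auto simp: permutation_self_in_orbit p)
  then show "orbit ?q u = orbit p u \<union> orbit p v" "orbit ?q v = orbit p u \<union> orbit p v"
    using 1 2 3 by auto
qed

lemma orbit_comp_transpose_other:
  assumes p: "permutation p" and "u \<notin> orbit p x" "v \<notin> orbit p x"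
  shows "orbit (p \<circ> transpose u v) x = orbit p x"
  using assms permutation_self_in_orbit[OF p]
  by (intro orbit_cong) (auto simp: transpose_def)

lemma ncyc_merge:
  assumes p: "permutation p" and fin: "finite A" and u: "u \<in> A" and vA: "v \<in> A"
    and v: "v \<notin> orbit p u"
  shows "ncyc A p = Suc (ncyc A (p \<circ> transpose u v))"
proof -
  let ?q = "p \<circ> transpose u v"
  let ?O = "orbit p ` A - {orbit p u, orbit p v}"
  have ne: "orbit p u \<noteq> orbit p v"
    using v permutation_self_in_orbit[OF p] by auto
  have oth: "orbit p x = orbit p u \<or> orbit p x = orbit p v \<or> orbit ?q x = orbit p x" for x
  proof (cases "u \<in> orbit p x \<or> v \<in> orbit p x")
    case True
    then show ?thesis using orbit_eq_of_mem[OF p] by metis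
  next
    case False
    then show ?thesis using orbit_comp_transpose_other[OF p] by metis
  qed
  have q: "permutation ?q"
    by (intro permutation_compose p permutation_swap_id)
  note m = orbit_comp_transpose[OF p v]
  have in1: "orbit ?q x = orbit p u \<union> orbit p v"
    if "orbit p x = orbit p u \<or> orbit p x = orbit p v" for x
  proof -
    have "x \<in> orbit ?q u"
      unfolding m using that permutation_self_in_orbit[OF p, of x] by auto
    from orbit_eq_of_mem[OF q this] show ?thesis by (simp add: m)
  qed
  have eq: "orbit ?q ` A = insert (orbit p u \<union> orbit p v) ?O"
  proof (intro equalityI subsetI)
    fix X assume "X \<in> orbit ?q ` A"
    then obtain x where "x \<in> A" "X = orbit ?q x" by blast
    then show "X \<in> insert (orbit p u \<union> orbit p v) ?O"
      using oth[of x] in1[of x] by (cases "orbit p x \<in> {orbit p u, orbit p v}") auto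
  next
    fix X assume "X \<in> insert (orbit p u \<union> orbit p v) ?O"
    then show "X \<in> orbit ?q ` A"
    proof
      assume "X = orbit p u \<union> orbit p v"
      then show ?thesis using m(1) u by (metis image_eqI)
    next
      assume "X \<in> ?O"
      then obtain x where "x \<in> A" "X = orbit p x" "X \<noteq> orbit p u" "X \<noteq> orbit p v" by blast
      then show ?thesis using oth[of x] by (metis image_eqI)
    qed
  qed
  have notin: "orbit p u \<union> orbit p v \<notin> ?O"
  proof
    assume "orbit p u \<union> orbit p v \<in> ?O"
    then obtain x where x: "orbit p u \<union> orbit p v = orbit p x" "orbit p x \<noteq> orbit p u" by auto
    then have "u \<in> orbit p x" using permutation_self_in_orbit[OF p] by auto
    from orbit_eq_of_mem[OF p this] x show False by auto
  qed
  have "card (orbit ?q ` A) = Suc (card ?O)"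
    unfolding eq using notin fin by simp
  moreover have "card (orbit p ` A) = Suc (Suc (card ?O))"
  proof -
    have "orbit p ` A = insert (orbit p u) (insert (orbit p v) ?O)"
      using u vA by auto
    then show ?thesis using fin ne by (metis (no_types, lifting) Diff_iff card_insert_disjoint
      finite_Diff finite_imageI finite_insert insert_iff)
  qed
  ultimately show ?thesis by (simp add: ncyc_def)
qed

text \<open>If u and v share an orbit of p, every orbit of the product lies inside an orbit of p, so
  the count cannot drop; otherwise it drops by exactly one.\<close>

lemma ncyc_comp_transpose_ge:
  assumes p: "permutation p" and fin: "finite A" and pA: "p ` A \<subseteq> A" and u: "u \<in> A" and vA: "v \<in> A"
  shows "ncyc A p \<le> Suc (ncyc A (p \<circ> transpose u v))"
proof (cases "v \<in> orbit p u")
  case False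
  then show ?thesis using ncyc_merge[OF p fin u vA] by simp
next
  case True
  let ?q = "p \<circ> transpose u v"
  have q: "permutation ?q"
    by (intro permutation_compose p permutation_swap_id)
  have sub: "orbit ?q x \<subseteq> orbit p x" for x
  proof (rule orbit_subset_invariant)
    show "x \<in> orbit p x" by (rule permutation_self_in_orbit[OF p])
    have "p u \<in> orbit p x" if "v \<in> orbit p x"
      using that True orbit_eq_of_mem[OF p] by (metis orbit.base)
    moreover have "p v \<in> orbit p x" if "u \<in> orbit p x"
      using that True orbit_eq_of_mem[OF p] by (metis orbit.base)
    ultimately show "?q ` orbit p x \<subseteq> orbit p x"
      by (auto simp: transpose_def intro: orbit.step)
  qed
  \<comment> \<open>Sending an orbit of \<open>?q\<close> to the orbit of p around any of its points
    is a map onto the orbits of p.\<close>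
  have "orbit p ` A = (\<lambda>X. orbit p (SOME x. x \<in> X)) ` (orbit ?q ` A)"
  proof -
    have "orbit p (SOME y. y \<in> orbit ?q x) = orbit p x" for x
    proof -
      have "(SOME y. y \<in> orbit ?q x) \<in> orbit ?q x"
        by (rule someI) (rule orbit.base)
      then show ?thesis using sub orbit_eq_of_mem[OF p] by blast
    qed
    then show ?thesis by (simp add: image_image)
  qed
  then have "card (orbit p ` A) \<le> card (orbit ?q ` A)"
    using fin by (metis card_image_le finite_imageI)
  then show ?thesis by (simp add: ncyc_def)
qed

section \<open>Building permutations point by point\<close>

lemma ncyc_insert_fixed:
  assumes "finite A" "a \<notin> A" "p permutes A"
  shows "ncyc (insert a A) p = Suc (ncyc A p)"
proof -
  have "p a = a" using assms by (simp add: permutes_not_in)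
  then have "orbit p a = {a}" by (simp add: orbit_eq_singleton_iff)
  moreover have "{a} \<notin> orbit p ` A"
  proof
    assume "{a} \<in> orbit p ` A"
    then obtain x where "x \<in> A" "orbit p x = {a}" by auto
    then show False using permutes_orbit_subset[OF assms(3)] assms(2) by auto
  qed
  ultimately show ?thesis using assms(1) by (simp add: ncyc_def)
qed

lemma ncyc_insert_transpose:
  assumes "finite A" "a \<notin> A" "p permutes A" "b \<in> A"
  shows "ncyc (insert a A) (p \<circ> transpose b a) = ncyc A p"
proof -
  have p: "permutation p" using assms permutation_permutes by blast
  have "a \<notin> orbit p b" using permutes_orbit_subset[OF assms(3,4)] assms(2) by auto
  from ncyc_merge[OF p _ _ _ this, of "insert a A"] show ?thesis
    using assms ncyc_insert_fixed[OF assms(1-3)] by simp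
qed

lemma ncyc_inv: "permutation p \<Longrightarrow> ncyc A (inv p) = ncyc A p"
  by (simp add: ncyc_def orbit_inv_eq)

text \<open>The point b is the preimage of a under p. This factorisation drives the inductions on
  sets: adjoining a either creates a fixed point (b = a) or inserts a into the cycle of b.\<close>

lemma permutes_insert_right:
  assumes "p permutes insert a A" "a \<notin> A"
  obtains q b where "q permutes A" "b \<in> insert a A" "p = q \<circ> transpose b a"
proof -
  from assms(1) have "inv p permutes insert a A" by (rule permutes_inv)
  then have r: "transpose a (inv p a) \<circ> inv p permutes A" by (rule permutes_insert_lemma)
  let ?r = "transpose a (inv p a) \<circ> inv p"
  have "inv ?r = inv (inv p) \<circ> inv (transpose a (inv p a))"
    using permutes_bij[OF permutes_inv[OF assms(1)]] by (intro o_inv_distrib) auto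
  then have "inv ?r = p \<circ> transpose a (inv p a)"
    by (simp add: permutes_inv_inv[OF assms(1)])
  then have "p = inv ?r \<circ> transpose (inv p a) a"
    by (simp add: fun_eq_iff transpose_commute)
  moreover have "inv p a \<in> insert a A"
    by (simp only: permutes_in_image[OF permutes_inv[OF assms(1)]] insertI1)
  ultimately show ?thesis using permutes_inv[OF r] that by blast
qed

lemma ncyc_id: "ncyc A id = card A"
proof -
  have "orbit id x = {x}" for x :: 'a by (simp add: orbit_eq_singleton_iff)
  then have "orbit id ` A = (\<lambda>x. {x}) ` A" by simp
  then show ?thesis by (simp add: ncyc_def card_image)
qed

lemma sign_eq_ncyc:
  assumes "finite A" "p permutes A"
  shows "sign p = (-1) ^ (card A + ncyc A p)"
  using assms
proof (induction A arbitrary: p rule: finite_induct)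
  case empty
  then show ?case by (simp add: ncyc_def)
next
  case (insert a A)
  obtain q b where q: "q permutes A" "b \<in> insert a A" "p = q \<circ> transpose b a"
    using permutes_insert_right[OF insert.prems insert.hyps(2)] .
  have pq: "permutation q" using q insert.hyps permutation_permutes by blast
  show ?case
  proof (cases "b = a")
    case True
    then have "p = q" using q by (simp add: fun_eq_iff)
    then show ?thesis using insert q ncyc_insert_fixed[OF insert.hyps(1,2) q(1)] by simp
  next
    case False
    then have b: "b \<in> A" using q by simp
    show ?thesis
      unfolding q(3) ncyc_insert_transpose[OF insert.hyps(1,2) q(1) b]
        sign_compose[OF pq permutation_swap_id] sign_swap_id insert.IH[OF q(1)]
      using insert.hyps False by simp
  qed
qed

text \<open>The difference \<open>card A - ncyc A p\<close> is the least number of transpositions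
  with product p, hence subadditive. The set F moved by q is kept apart from A: the induction
  shrinks F, while p and the counted cycles stay those on A.\<close>

lemma ncyc_comp_ge:
  assumes "finite A" "F \<subseteq> A" "p permutes A" "q permutes F"
  shows "ncyc A p + ncyc A q \<le> card A + ncyc A (p \<circ> q)"
proof -
  have "finite F" using assms finite_subset by blast
  then show ?thesis using assms(2,4)
  proof (induction F arbitrary: q rule: finite_induct)
    case empty
    then have "q = id" by simp
    then show ?case by (metis add.commute comp_id ncyc_id order_refl)
  next
    case (insert a F)
    obtain r b where r: "r permutes F" "b \<in> insert a F" "q = r \<circ> transpose b a"
      using permutes_insert_right[OF insert.prems(2) insert.hyps(2)] .
    have rA: "r permutes A" using r insert.prems permutes_subset by blast
    have IH: "ncyc A p + ncyc A r \<le> card A + ncyc A (p \<circ> r)"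
      using insert.IH[OF _ r(1)] insert.prems(1) by blast
    show ?case
    proof (cases "b = a")
      case True
      then have "q = r" using r by (simp add: fun_eq_iff)
      with IH show ?thesis by metis
    next
      case False
      have pr: "permutation r" using rA assms(1) permutation_permutes by blast
      have "r a = a" using r insert.hyps by (simp add: permutes_not_in)
      \<comment> \<open>As r fixes a, passing from r to q merges two cycles and costs exactly one,
        whereas the same transposition costs \<open>p \<circ> r\<close> at most one.\<close>
      then have "a \<notin> orbit r b"
        using False by (metis insert.hyps(2) insertE permutes_orbit_subset r(1,2) subsetD)
      then have 1: "ncyc A r = Suc (ncyc A q)"
        unfolding r(3) using insert.prems r by (intro ncyc_merge pr assms(1)) auto
      have prr: "p \<circ> r permutes A" using assms(3) rA permutes_compose by blast
      have "ncyc A (p \<circ> r) \<le> Suc (ncyc A ((p \<circ> r) \<circ> transpose b a))"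
      proof (rule ncyc_comp_transpose_ge)
        show "permutation (p \<circ> r)" using prr assms(1) permutation_permutes by blast
        show "(p \<circ> r) ` A \<subseteq> A" using permutes_image[OF prr] by simp
      qed (use insert.prems r assms(1) in auto)
      then show ?thesis using IH 1 by (simp add: r(3) comp_def)
    qed
  qed
qed

text \<open>A new point has weight y as a fixed point and weight 1 in each of the
  \<open>card A\<close> places where it can enter an existing cycle.\<close>

lemma sum_power_ncyc:
  fixes y :: "'b :: comm_ring_1"
  assumes "finite A"
  shows "(\<Sum>p | p permutes A. y ^ ncyc A p) = (\<Prod>i<card A. y + of_nat i)"
  using assms
proof (induction A rule: finite_induct)
  case empty
  then show ?case by (simp add: ncyc_def)
next
  case (insert a A)
  let ?f = "\<lambda>(b, q). q \<circ> transpose b a"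
  let ?D = "insert a A \<times> {q. q permutes A}"
  have inv: "b = inv (q \<circ> transpose b a) a" if "q permutes A" "b \<in> insert a A" for b q
  proof -
    have "inj (q \<circ> transpose b a)"
      using that permutes_inj by (intro inj_compose) auto
    moreover have "(q \<circ> transpose b a) b = a"
      using that insert.hyps by (simp add: permutes_not_in)
    ultimately show ?thesis by (metis inv_f_f)
  qed
  have inj: "inj_on ?f ?D"
  proof (rule inj_onI, clarify)
    fix b q c r
    assume a: "b \<in> insert a A" "q permutes A" "c \<in> insert a A" "r permutes A"
      and eq: "q \<circ> transpose b a = r \<circ> transpose c a"
    then have bc: "b = c" using inv[of q b] inv[of r c] by simp
    then have "q = r" using eq by (metis comp_assoc comp_id transpose_comp_involutory)
    then show "b = c \<and> q = r" using bc by simp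
  qed
  have im: "?f ` ?D = {p. p permutes insert a A}"
  proof (intro equalityI subsetI)
    fix p assume "p \<in> ?f ` ?D"
    then obtain b q where bq: "b \<in> insert a A" "q permutes A" "p = q \<circ> transpose b a" by auto
    have "transpose b a permutes insert a A" using bq by (intro permutes_swap_id) auto
    moreover have "q permutes insert a A" using bq by (intro permutes_imp_permutes_insert)
    ultimately show "p \<in> {p. p permutes insert a A}" using bq permutes_compose by blast
  next
    fix p assume "p \<in> {p. p permutes insert a A}"
    then have "p permutes insert a A" by simp
    then obtain q b where "q permutes A" "b \<in> insert a A" "p = q \<circ> transpose b a"
      using insert.hyps(2) by (rule permutes_insert_right)
    then show "p \<in> ?f ` ?D" by (intro image_eqI[of _ _ "(b, q)"]) simp_all
  qed
  have "(\<Sum>p | p permutes insert a A. y ^ ncyc (insert a A) p)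
      = (\<Sum>(b, q)\<in>?D. y ^ ncyc (insert a A) (q \<circ> transpose b a))"
    unfolding im[symmetric] by (subst sum.reindex[OF inj]) (simp add: case_prod_unfold)
  also have "\<dots> = (\<Sum>b\<in>insert a A. \<Sum>q | q permutes A. y ^ ncyc (insert a A) (q \<circ> transpose b a))"
    by (simp add: sum.cartesian_product)
  also have "\<dots> = (\<Sum>b\<in>insert a A. (if b = a then y else 1) * (\<Sum>q | q permutes A. y ^ ncyc A q))"
  proof (intro sum.cong refl)
    fix b assume b: "b \<in> insert a A"
    have "y ^ ncyc (insert a A) (q \<circ> transpose b a) = (if b = a then y else 1) * y ^ ncyc A q"
      if "q permutes A" for q
      using b that insert.hyps ncyc_insert_transpose[OF insert.hyps that, of b]
        ncyc_insert_fixed[OF insert.hyps that] by auto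
    then show "(\<Sum>q | q permutes A. y ^ ncyc (insert a A) (q \<circ> transpose b a))
        = (if b = a then y else 1) * (\<Sum>q | q permutes A. y ^ ncyc A q)"
      by (simp add: sum_distrib_left)
  qed
  also have "\<dots> = (y + of_nat (card A)) * (\<Prod>i<card A. y + of_nat i)"
  proof -
    have "(\<Sum>b\<in>insert a A. (if b = a then y else (1::'b))) = y + (\<Sum>b\<in>A. if b = a then y else 1)"
      using insert.hyps by simp
    also have "(\<Sum>b\<in>A. if b = a then y else (1::'b)) = (\<Sum>b\<in>A. 1)"
      using insert.hyps(2) by (intro sum.cong) auto
    finally have "(\<Sum>b\<in>insert a A. (if b = a then y else (1::'b))) = y + of_nat (card A)"
      by simp
    then show ?thesis by (simp add: insert.IH flip: sum_distrib_right)
  qed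
  finally show ?case using insert.hyps by (simp add: mult.commute)
qed

section \<open>Signs on stable subsets\<close>

text \<open>For a stable set S this is the coefficient of the basis vector of S in its own image
  under the exterior power of p. Through \<open>restrict_id\<close> it depends only on the values of
  p on S, so it applies to maps that also move points outside S.\<close>

definition rsign :: "'a set \<Rightarrow> ('a \<Rightarrow> 'a) \<Rightarrow> complex" where
  "rsign S p = of_int (sign (restrict_id p S))"

lemma rsign_cong:
  assumes "\<And>x. x \<in> S \<Longrightarrow> p x = q x"
  shows "rsign S p = rsign S q"
proof -
  have "restrict_id p S = restrict_id q S"
    using assms by (auto simp: restrict_id_def fun_eq_iff)
  then show ?thesis by (simp only: rsign_def)
qed

lemma restrict_id_permutes:
  assumes "finite S" "p ` S = S"
  shows "restrict_id p S permutes S"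
  using assms by (intro permutes_restrict_id) (simp add: bij_betw_def finite_surj_inj)

lemma rsign_comp:
  assumes "finite S" "p ` S = S" "q ` S = S"
  shows "rsign S (p \<circ> q) = rsign S p * rsign S q"
proof -
  have "q x \<in> S" if "x \<in> S" for x using that assms by auto
  then have eq: "restrict_id (p \<circ> q) S = restrict_id p S \<circ> restrict_id q S"
    by (auto simp: restrict_id_def fun_eq_iff)
  have "permutation (restrict_id r S)" if "r ` S = S" for r
    using restrict_id_permutes[OF assms(1) that] assms(1) permutation_permutes by blast
  then show ?thesis using assms by (simp only: rsign_def eq sign_compose of_int_mult)
qed

lemma rsign_permutes: "p permutes S \<Longrightarrow> rsign S p = of_int (sign p)"
proof -
  assume "p permutes S"
  then have "restrict_id p S = p" by (auto simp: restrict_id_def fun_eq_iff permutes_not_in)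
  then show ?thesis by (simp only: rsign_def)
qed

lemma rsign_transpose:
  assumes "u \<in> S" "v \<in> S"
  shows "rsign S (transpose u v) = (if u = v then 1 else -1)"
  using permutes_swap_id[OF assms] by (simp add: rsign_permutes sign_swap_id)

lemma rsign_eq_ncyc:
  assumes "finite S" "p ` S = S"
  shows "rsign S p = (-1) ^ (card S + ncyc S p)"
proof -
  have "orbit (restrict_id p S) x = orbit p x" if "x \<in> S" for x
    using assms that by (intro orbit_cong0[of x S]) auto
  then have "orbit (restrict_id p S) ` S = orbit p ` S" by simp
  then show ?thesis
    using sign_eq_ncyc[OF assms(1) restrict_id_permutes[OF assms]]
    by (simp add: rsign_def ncyc_def)
qed

lemma ncyc_split:
  assumes "finite A" "S \<subseteq> A" "p permutes A" "p ` S = S"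
  shows "ncyc A p = ncyc S p + ncyc (A - S) p"
proof -
  have p: "permutation p" using assms permutation_permutes by blast
  have "orbit p ` S \<inter> orbit p ` (A - S) = {}"
  proof (rule ccontr)
    assume "orbit p ` S \<inter> orbit p ` (A - S) \<noteq> {}"
    then obtain x y where "x \<in> S" "y \<notin> S" "orbit p x = orbit p y" by auto
    moreover from this have "y \<in> orbit p x" using permutation_self_in_orbit[OF p] by simp
    ultimately show False using orbit_subset_invariant[of x S p] assms(4) by auto
  qed
  moreover have "orbit p ` A = orbit p ` S \<union> orbit p ` (A - S)"
    using assms(2) by auto
  moreover have "finite S" using assms finite_subset by blast
  ultimately show ?thesis
    using assms(1) by (simp add: ncyc_def card_Un_disjoint)
qed

lemma ncyc_cong:
  assumes "p ` S \<subseteq> S" "\<And>x. x \<in> S \<Longrightarrow> p x = q x"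
  shows "ncyc S p = ncyc S q"
proof -
  have "orbit p x = orbit q x" if "x \<in> S" for x
    using assms that by (intro orbit_cong0[of x S]) auto
  then have "orbit p ` S = orbit q ` S" by simp
  then show ?thesis by (simp add: ncyc_def)
qed

section \<open>Weighted sums over stabilisers of subsets and their cosets\<close>

lemma sum_signed_ncyc:
  fixes x :: complex
  assumes "finite S"
  shows "(\<Sum>p | p permutes S. x ^ ncyc S p * rsign S p) = (\<Prod>i<card S. x - of_nat i)"
proof -
  have "(\<Sum>p | p permutes S. x ^ ncyc S p * rsign S p)
      = (\<Sum>p | p permutes S. (-1) ^ card S * (- x) ^ ncyc S p)"
  proof (intro sum.cong refl)
    fix p assume "p \<in> {p. p permutes S}"
    then have "rsign S p = (-1) ^ (card S + ncyc S p)"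
      using assms by (intro rsign_eq_ncyc) (auto simp: permutes_image)
    then show "x ^ ncyc S p * rsign S p = (-1) ^ card S * (- x) ^ ncyc S p"
      by (simp add: power_add power_minus[of x])
  qed
  \<comment> \<open>The sign has turned x into -x, so the rising factorial at -x becomes a falling
    factorial at x.\<close>
  also have "\<dots> = (-1) ^ card S * (\<Prod>i<card S. - x + of_nat i)"
    using sum_power_ncyc[OF assms, of "- x"] by (simp flip: sum_distrib_left)
  also have "\<dots> = (\<Prod>i<card S. (-1) * (- x + of_nat i))"
    by (simp only: prod.distrib prod_constant card_lessThan)
  also have "\<dots> = (\<Prod>i<card S. x - of_nat i)"
    by simp
  finally show ?thesis .
qed

text \<open>The stabiliser is the product of the symmetric groups on S and on its complement, cycles
  add up, and the sign sees only the factor on S: one factor gives a falling, the other a rising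
  factorial.\<close>

lemma sum_stabilizer:
  fixes x :: complex
  assumes fin: "finite A" and SA: "S \<subseteq> A"
  shows "(\<Sum>p | p permutes A \<and> p ` S = S. x ^ ncyc A p * rsign S p)
    = (\<Prod>i<card S. x - of_nat i) * (\<Prod>i<card A - card S. x + of_nat i)"
proof -
  let ?P = "{p. p permutes S} \<times> {q. q permutes A - S}"
  have fS: "finite S" using assms finite_subset by blast
  have val: "(p \<circ> q) y = (if y \<in> S then p y else q y)" if "p permutes S" "q permutes A - S" for p q y
  proof (cases "y \<in> S")
    case True
    then have "q y = y" using that by (simp add: permutes_not_in)
    then show ?thesis using True by simp
  next
    case False
    then have "q y \<notin> S"
      using that(2) by (metis DiffD2 permutes_in_image permutes_not_in)
    then show ?thesis using False permutes_not_in[OF that(1)] by simp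
  qed
  have pAS: "p ` (A - S) = A - S" if "p permutes A" "p ` S = S" for p
    using image_set_diff[OF permutes_inj[OF that(1)], of A S] that by (simp add: permutes_image)
  have "(\<Sum>p | p permutes A \<and> p ` S = S. x ^ ncyc A p * rsign S p)
    = (\<Sum>(p, q)\<in>?P. (x ^ ncyc S p * rsign S p) * x ^ ncyc (A - S) q)"
  proof (rule sum.reindex_bij_witness[where i = "\<lambda>(p, q). p \<circ> q"
        and j = "\<lambda>p. (restrict_id p S, restrict_id p (A - S))"], goal_cases)
    case (1 p)
    then have p: "p permutes A" "p ` S = S" by auto
    have "p x \<notin> S" if "x \<in> A - S" for x using pAS[OF p] that by auto
    then show ?case using p by (auto simp: fun_eq_iff restrict_id_def permutes_not_in)
  next
    case (2 p)
    then have p: "p permutes A" "p ` S = S" by auto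
    then have "p ` (A - S) = A - S" by (rule pAS)
    then show ?case using fin fS p by (auto intro: restrict_id_permutes)
  next
    case (3 b)
    then obtain p q where b: "b = (p, q)" "p permutes S" "q permutes A - S" by auto
    then show ?case
      using val[OF b(2,3)] by (auto simp: fun_eq_iff restrict_id_def permutes_not_in)
  next
    case (4 b)
    then obtain p q where b: "b = (p, q)" "p permutes S" "q permutes A - S" by auto
    have "p permutes A" "q permutes A" using b SA by (auto intro: permutes_subset)
    moreover have "(p \<circ> q) ` S = p ` S" using val[OF b(2,3)] by auto
    moreover have "p ` S = S" using b(2) by (rule permutes_image)
    ultimately show ?case
      by (simp only: b prod.case mem_Collect_eq permutes_compose simp_thms)
  next
    case (5 p)
    then have p: "p permutes A" "p ` S = S" by auto
    then have pS: "p ` (A - S) = A - S" by (rule pAS)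
    have "ncyc S (restrict_id p S) = ncyc S p" "ncyc (A - S) (restrict_id p (A - S)) = ncyc (A - S) p"
      using p pS by (intro ncyc_cong[symmetric]; simp)+
    moreover have "rsign S (restrict_id p S) = rsign S p"
      by (rule rsign_cong) simp
    ultimately show ?case
      using ncyc_split[OF fin SA p] by (simp add: power_add)
  qed
  also have "\<dots> = (\<Sum>p | p permutes S. x ^ ncyc S p * rsign S p)
      * (\<Sum>q | q permutes A - S. x ^ ncyc (A - S) q)"
    by (simp add: sum_product sum.cartesian_product)
  finally show ?thesis
    using fin fS SA by (simp add: sum_signed_ncyc sum_power_ncyc card_Diff_subset)
qed

text \<open>The share of S in the convolution of the cycle weight with \<open>ext_char\<close>. When
  t permutes A, the s in the sum form a coset of the stabiliser of S.\<close>

definition coset_sum :: "'a set \<Rightarrow> complex \<Rightarrow> ('a \<Rightarrow> 'a) \<Rightarrow> 'a set \<Rightarrow> complex" where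
  "coset_sum A x t S = (\<Sum>s | s permutes A \<and> (s \<circ> t) ` S = S. x ^ ncyc A s * rsign S (s \<circ> t))"

lemma ncyc_conj_transpose:
  assumes "finite A" "s permutes A" "u \<in> A" "v \<in> A"
  shows "ncyc A (transpose u v \<circ> s \<circ> transpose u v) = ncyc A s"
proof -
  let ?w = "transpose u v"
  have p: "permutation s" using assms permutation_permutes by blast
  have "orbit (?w \<circ> s \<circ> ?w) (?w y) = ?w ` orbit s y" for y
    by (rule orbit_inverse[symmetric]) (simp_all add: permutation_self_in_orbit p)
  moreover have "?w ` A = A" using assms by (simp add: permutes_image permutes_swap_id)
  ultimately have "orbit (?w \<circ> s \<circ> ?w) ` A = (\<lambda>X. ?w ` X) ` orbit s ` A"
    by (metis (no_types, lifting) image_cong image_image)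
  moreover have "inj_on (\<lambda>X. ?w ` X) (orbit s ` A)"
    by (rule inj_on_image) simp
  ultimately show ?thesis by (simp add: ncyc_def card_image)
qed

text \<open>Conjugating \<open>s\<close> by \<open>(u v)\<close> preserves the number of cycles, but changes \<open>s \<circ> t\<close> on \<open>S\<close>
  only by a left factor \<open>(u v)\<close>, because \<open>t ` S\<close> avoids \<open>u\<close> and \<open>v\<close>.\<close>

lemma coset_sum_eq_0:
  assumes fin: "finite A" and SA: "S \<subseteq> A"
    and uv: "u \<in> S" "v \<in> S" "u \<noteq> v" "u \<notin> t ` S" "v \<notin> t ` S"
  shows "coset_sum A x t S = 0"
proof -
  let ?w = "transpose u v"
  let ?c = "\<lambda>s. ?w \<circ> s \<circ> ?w"
  have fS: "finite S" using fin SA finite_subset by blast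
  have uvA: "u \<in> A" "v \<in> A" using uv SA by auto
  have wS: "?w ` S = S" using uv by (simp add: permutes_image permutes_swap_id)
  have ctx: "(?c s \<circ> t) y = (?w \<circ> (s \<circ> t)) y" if "y \<in> S" for s y
  proof -
    have "t y \<noteq> u" "t y \<noteq> v" using that uv by auto
    then show ?thesis by simp
  qed
  have mem: "?c s permutes A \<and> (?c s \<circ> t) ` S = S" if "s permutes A" "(s \<circ> t) ` S = S" for s
  proof -
    have "(?c s \<circ> t) ` S = ?w ` (s \<circ> t) ` S"
      using ctx[of _ s] by (simp only: image_comp) (rule image_cong, simp_all only:)
    moreover have "?c s permutes A"
      using that uvA by (intro permutes_compose permutes_swap_id)
    ultimately show ?thesis using that wS by simp
  qed
  have val: "x ^ ncyc A (?c s) * rsign S (?c s \<circ> t) = - (x ^ ncyc A s * rsign S (s \<circ> t))"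
    if "s permutes A" "(s \<circ> t) ` S = S" for s
  proof -
    have "rsign S (?c s \<circ> t) = rsign S (?w \<circ> (s \<circ> t))"
      using ctx by (rule rsign_cong)
    also have "\<dots> = - rsign S (s \<circ> t)"
      using uv by (simp only: rsign_comp[OF fS wS that(2)] rsign_transpose) simp
    finally show ?thesis using ncyc_conj_transpose[OF fin that(1) uvA] by simp
  qed
  have "coset_sum A x t S = (\<Sum>s | s permutes A \<and> (s \<circ> t) ` S = S. - (x ^ ncyc A s * rsign S (s \<circ> t)))"
    unfolding coset_sum_def
  proof (rule sum.reindex_bij_witness[where i = ?c and j = ?c], goal_cases)
    case (5 s)
    then show ?case using val[of s] by auto
  qed (use mem in \<open>auto simp: fun_eq_iff\<close>)
  also have "\<dots> = - coset_sum A x t S" by (simp add: coset_sum_def sum_negf)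
  finally show ?thesis by simp
qed

lemma coset_sum_stable:
  assumes fin: "finite A" and SA: "S \<subseteq> A" and t: "t ` S = S"
  shows "coset_sum A x t S = (\<Prod>i<card S. x - of_nat i) * (\<Prod>i<card A - card S. x + of_nat i) * rsign S t"
proof -
  have fS: "finite S" using fin SA finite_subset by blast
  have st: "(s \<circ> t) ` S = s ` S" for s by (metis image_comp t)
  have "coset_sum A x t S = (\<Sum>s | s permutes A \<and> s ` S = S. x ^ ncyc A s * rsign S s * rsign S t)"
    unfolding coset_sum_def st by (rule sum.cong) (auto simp: rsign_comp[OF fS _ t])
  then show ?thesis
    by (simp add: sum_stabilizer[OF fin SA, symmetric] sum_distrib_right)
qed

text \<open>Since \<open>transpose u v \<circ> t\<close> stabilises S, the s in the sum are the
  products of stabilising permutations with (u v). A stabilising permutation has u and v in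
  different cycles, so the product has one cycle fewer; this accounts for the factor x on the
  left.\<close>

lemma coset_sum_near:
  assumes fin: "finite A" and SA: "S \<subseteq> A" and u: "u \<in> S" and v: "v \<in> A - S"
    and t: "t ` S = insert v (S - {u})"
  shows "x * coset_sum A x t S
    = (\<Prod>i<card S. x - of_nat i) * (\<Prod>i<card A - card S. x + of_nat i) * rsign S (transpose u v \<circ> t)"
proof -
  let ?w = "transpose u v"
  have fS: "finite S" using fin SA finite_subset by blast
  have wt: "(?w \<circ> t) ` S = S"
  proof -
    have "?w ` (S - {u}) = S - {u}" using v by (force simp: transpose_def)
    then have "?w ` (t ` S) = insert u (S - {u})" unfolding t by simp
    then show ?thesis using u by (metis image_comp insert_Diff)
  qed
  have stw: "(s \<circ> ?w \<circ> t) ` S = s ` S" for s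
    using wt by (metis comp_assoc image_comp)
  have uvA: "u \<in> A" "v \<in> A" using u v SA by auto
  have "x * coset_sum A x t S
    = (\<Sum>s | s permutes A \<and> (s \<circ> t) ` S = S. x ^ Suc (ncyc A s) * rsign S (s \<circ> t))"
    by (simp add: coset_sum_def sum_distrib_left mult.assoc)
  also have "\<dots> = (\<Sum>s | s permutes A \<and> s ` S = S. x ^ ncyc A s * rsign S s * rsign S (?w \<circ> t))"
  proof (rule sum.reindex_bij_witness[where i = "\<lambda>s. s \<circ> ?w" and j = "\<lambda>s. s \<circ> ?w"], goal_cases)
    case (1 s)
    then show ?case by (simp add: comp_assoc)
  next
    case (2 s)
    have "(s \<circ> ?w) ` S = (s \<circ> ?w \<circ> ?w \<circ> t) ` S" using stw[of "s \<circ> ?w"] by simp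
    also have "\<dots> = (s \<circ> t) ` S" by (simp add: comp_assoc)
    finally show ?case using 2 uvA by (auto intro: permutes_compose permutes_swap_id)
  next
    case (3 s)
    then show ?case by (simp add: comp_assoc)
  next
    case (4 s)
    then have "s permutes A" "s ` S = S" by auto
    moreover from this have "(s \<circ> ?w \<circ> t) ` S = S" by (simp only: stw)
    ultimately show ?case
      using permutes_compose[OF permutes_swap_id[OF uvA]] by blast
  next
    case (5 s)
    let ?s = "s \<circ> ?w"
    have s: "s permutes A" "(s \<circ> t) ` S = S" using 5 by auto
    have ss: "?s permutes A" using s uvA by (auto intro: permutes_compose permutes_swap_id)
    have "?s ` S = (?s \<circ> ?w \<circ> t) ` S" using stw[of ?s] by simp
    also have "?s \<circ> ?w \<circ> t = s \<circ> t" by (simp add: comp_assoc)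
    finally have sS: "?s ` S = S" using s by simp
    have "permutation ?s" using ss fin permutation_permutes by blast
    moreover have "v \<notin> orbit ?s u"
      using orbit_subset_invariant[of u S ?s] u v sS by auto
    ultimately have "ncyc A ?s = Suc (ncyc A (?s \<circ> ?w))"
      using fin uvA by (intro ncyc_merge)
    moreover have "?s \<circ> ?w = s" by (simp add: comp_assoc)
    moreover have "rsign S (s \<circ> t) = rsign S ?s * rsign S (?w \<circ> t)"
      using rsign_comp[OF fS sS wt] by (simp add: \<open>?s \<circ> ?w \<circ> t = s \<circ> t\<close> flip: comp_assoc)
    ultimately show ?case by simp
  qed
  finally show ?thesis
    by (simp add: sum_stabilizer[OF fin SA, symmetric] sum_distrib_right)
qed

section \<open>Hook characters\<close>

text \<open>\<open>ext_char A k\<close> is the character of the \<open>k\<close>-th exterior power of the permutation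
  representation, and \<open>hook_char A k\<close> is \<open>card A\<close> times the irreducible character of the hook with a
  leg of length \<open>k\<close>.\<close>

definition ext_char :: "'a set \<Rightarrow> nat \<Rightarrow> ('a \<Rightarrow> 'a) \<Rightarrow> complex" where
  "ext_char A k t = (\<Sum>S | S \<subseteq> A \<and> card S = k \<and> t ` S = S. rsign S t)"

definition near_pairs :: "'a set \<Rightarrow> ('a \<Rightarrow> 'a) \<Rightarrow> 'a set \<Rightarrow> ('a \<times> 'a) set" where
  "near_pairs A t S = {(u, v). u \<in> S \<and> v \<in> A - S \<and> t ` S = insert v (S - {u})}"

text \<open>The trace of t followed by the exchange operator N: t replaces one point u of S by v,
  and exchanging v for u restores S. A stable S has no such pair, any other S at most one.\<close>

definition near_sum :: "'a set \<Rightarrow> nat \<Rightarrow> ('a \<Rightarrow> 'a) \<Rightarrow> complex" where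
  "near_sum A k t = (\<Sum>S | S \<subseteq> A \<and> card S = k.
     \<Sum>(u, v)\<in>near_pairs A t S. rsign S (transpose u v \<circ> t))"

definition hook_char :: "'a set \<Rightarrow> nat \<Rightarrow> ('a \<Rightarrow> 'a) \<Rightarrow> complex" where
  "hook_char A k t = of_nat (card A - k) * ext_char A k t - near_sum A k t"

section \<open>Convolution of exterior characters with the cycle weight\<close>

lemma rel_eqI: "(\<And>u v. (u, v) \<in> P \<longleftrightarrow> (u, v) \<in> Q) \<Longrightarrow> P = Q"
  by auto

lemma finite_near_pairs: "finite A \<Longrightarrow> S \<subseteq> A \<Longrightarrow> finite (near_pairs A t S)"
  by (rule finite_subset[of _ "A \<times> A"]) (auto simp: near_pairs_def)

lemma finite_subsets: "finite A \<Longrightarrow> finite {S. S \<subseteq> A \<and> P S}"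
  by (rule finite_subset[of _ "Pow A"]) auto

text \<open>Here \<open>?h\<close> is the product for a stable set with one factor x split off, the
  factor that a nearly stable set loses. For every other S at least two points of S lie outside the
  image of S under t, and the sum cancels.\<close>

lemma coset_sum_eq:
  assumes fin: "finite A" and SA: "S \<subseteq> A" and t: "t permutes A" and x: "x \<noteq> 0"
    and k: "card S = Suc k"
  shows "coset_sum A x t S
    = (\<Prod>i<k. x - 1 - of_nat i) * (\<Prod>i<card A - Suc k. x + of_nat i)
      * (x * (if t ` S = S then rsign S t else 0)
        + (\<Sum>(u, v)\<in>near_pairs A t S. rsign S (transpose u v \<circ> t)))"
    (is "_ = ?h * (x * ?a + ?b)")
proof -
  have fS: "finite S" using fin SA finite_subset by blast
  have h: "(\<Prod>i<card S. x - of_nat i) * (\<Prod>i<card A - card S. x + of_nat i) = x * ?h"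
    unfolding k prod.lessThan_Suc_shift by (simp add: diff_diff_eq mult.assoc)
  have card: "card (t ` S) = card S"
    using permutes_inj_on[OF t] by (rule card_image)
  consider "t ` S = S" | u v where "(u, v) \<in> near_pairs A t S" |
    "t ` S \<noteq> S" "near_pairs A t S = {}"
    by (metis ex_in_conv surj_pair)
  then show ?thesis
  proof cases
    case 1
    then have "near_pairs A t S = {}" by (auto simp: near_pairs_def)
    then show ?thesis using 1 coset_sum_stable[OF fin SA 1, of x] h by simp
  next
    case (2 u v)
    then have uv: "u \<in> S" "v \<in> A - S" "t ` S = insert v (S - {u})"
      by (auto simp: near_pairs_def)
    have "near_pairs A t S = {(u, v)}"
      using uv by (auto simp: near_pairs_def)
    moreover have "t ` S \<noteq> S" using uv by auto
    moreover have "x * coset_sum A x t S = x * ?h * rsign S (transpose u v \<circ> t)"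
      using coset_sum_near[OF fin SA uv, of x] h by simp
    ultimately show ?thesis using x by simp
  next
    case 3
    have ne: "S - t ` S \<noteq> {}"
      using 3(1) card fS by (metis Diff_eq_empty_iff card_subset_eq finite_imageI)
    then obtain u where u: "u \<in> S" "u \<notin> t ` S" by auto
    have "\<exists>w \<in> S - t ` S. w \<noteq> u"
    proof (rule ccontr)
      assume "\<not> ?thesis"
      then have d: "S - t ` S = {u}" using u by blast
      have "card (t ` S - S) = card (S - t ` S)"
        using card fS by (simp add: card_Diff_subset_Int Int_commute)
      then obtain v where v: "t ` S - S = {v}" using d by (auto simp: card_1_singleton_iff)
      have "t ` S = (t ` S - S) \<union> (S - (S - t ` S))" by blast
      then have "t ` S = insert v (S - {u})" unfolding d v by simp
      moreover have "v \<in> A - S" using v SA permutes_image[OF t] by blast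
      ultimately show False using 3(2) u by (auto simp: near_pairs_def)
    qed
    then obtain w where w: "w \<in> S" "w \<notin> t ` S" "u \<noteq> w" by auto
    then show ?thesis using 3 coset_sum_eq_0[OF fin SA u(1) w(1,3) u(2) w(2), of x] by simp
  qed
qed

lemma sum_swap_ext_char:
  assumes fin: "finite A"
  shows "(\<Sum>s | s permutes A. x ^ ncyc A s * ext_char A k (s \<circ> t))
    = (\<Sum>S | S \<subseteq> A \<and> card S = k. coset_sum A x t S)"
proof -
  note fs = finite_subsets[OF fin]
  have "(\<Sum>s | s permutes A. x ^ ncyc A s * ext_char A k (s \<circ> t))
    = (\<Sum>s | s permutes A. \<Sum>S | S \<subseteq> A \<and> card S = k.
        if (s \<circ> t) ` S = S then x ^ ncyc A s * rsign S (s \<circ> t) else 0)"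
    unfolding ext_char_def sum_distrib_left
    by (intro sum.cong refl sum.mono_neutral_cong_left fs) auto
  also have "\<dots> = (\<Sum>S | S \<subseteq> A \<and> card S = k. \<Sum>s | s permutes A.
        if (s \<circ> t) ` S = S then x ^ ncyc A s * rsign S (s \<circ> t) else 0)"
    by (rule sum.swap)
  also have "\<dots> = (\<Sum>S | S \<subseteq> A \<and> card S = k. coset_sum A x t S)"
    unfolding coset_sum_def using finite_permutations[OF fin]
    by (intro sum.cong refl sum.mono_neutral_cong_right) auto
  finally show ?thesis .
qed

text \<open>In general the exterior character is not an eigenfunction, since it contains two hooks
  with different eigenvalues; the near sum is what separates them.\<close>

lemma convolution_ext_char:
  assumes fin: "finite A" and t: "t permutes A" and x: "x \<noteq> 0"
  shows "(\<Sum>s | s permutes A. x ^ ncyc A s * ext_char A (Suc k) (s \<circ> t))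
    = (\<Prod>i<k. x - 1 - of_nat i) * (\<Prod>i<card A - Suc k. x + of_nat i)
      * (x * ext_char A (Suc k) t + near_sum A (Suc k) t)" (is "_ = ?h * _")
proof -
  let ?F = "{S. S \<subseteq> A \<and> card S = Suc k}"
  note fs = finite_subsets[OF fin]
  have e: "ext_char A (Suc k) t = (\<Sum>S\<in>?F. if t ` S = S then rsign S t else 0)"
    unfolding ext_char_def by (intro sum.mono_neutral_cong_left fs) auto
  have "(\<Sum>s | s permutes A. x ^ ncyc A s * ext_char A (Suc k) (s \<circ> t))
    = (\<Sum>S\<in>?F. ?h * (x * (if t ` S = S then rsign S t else 0)
        + (\<Sum>(u, v)\<in>near_pairs A t S. rsign S (transpose u v \<circ> t))))"
    unfolding sum_swap_ext_char[OF fin]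
    by (intro sum.cong refl coset_sum_eq[OF fin _ t x]) auto
  then show ?thesis
    by (simp only: e near_sum_def sum.distrib distrib_left sum_distrib_left mult.assoc)
qed

lemma ext_char_0: "finite A \<Longrightarrow> ext_char A 0 t = 1"
proof -
  assume "finite A"
  then have "{S. S \<subseteq> A \<and> card S = 0 \<and> t ` S = S} = {{}}"
    by (auto dest: finite_subset)
  moreover have "restrict_id t {} = id" by (simp add: fun_eq_iff)
  ultimately show ?thesis by (simp add: ext_char_def rsign_def)
qed

lemma near_sum_0: "finite A \<Longrightarrow> near_sum A 0 t = 0"
  unfolding near_sum_def near_pairs_def by (rule sum.neutral) (auto dest: finite_subset)

lemma hook_char_0: "finite A \<Longrightarrow> hook_char A 0 t = of_nat (card A)"
  by (simp add: hook_char_def ext_char_0 near_sum_0)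

text \<open>The set \<open>S\<close> misses being \<open>t\<close>-stable by one arc; adding the point that follows the arc
  flips the sign.  In the index sets \<open>?P\<close> and \<open>?Q\<close> of the proof, the pairs \<open>u = v\<close>
  are the stable sets with a marked point.\<close>

lemma near_sum_Suc:
  assumes fin: "finite A" and t: "t permutes A"
  shows "near_sum A k t + near_sum A (Suc k) t
    = of_nat (card A - k) * ext_char A k t - of_nat (Suc k) * ext_char A (Suc k) t"
proof -
  let ?G = "\<lambda>k. {S. S \<subseteq> A \<and> card S = k}"
  let ?P = "\<lambda>S. {(u, v). v \<in> A - S \<and> u \<in> insert v S \<and> t ` S = insert v S - {u}}"
  let ?Q = "\<lambda>S. {(u, w). u \<in> S \<and> w \<in> A - (S - {u}) \<and> t ` S = insert w (S - {u})}"
  let ?r = "\<lambda>S u v. rsign S (transpose u v \<circ> t)"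
  let ?e = "\<lambda>u v. if u = v then 1 else (-1 :: complex)"
  have fG: "finite (?G k)" for k by (rule finite_subsets[OF fin])
  have fP: "finite (?P S)" if "S \<in> ?G k" for S k
  proof (rule finite_subset)
    show "?P S \<subseteq> A \<times> A" using that by blast
  qed (use fin in simp)
  have fQ: "finite (?Q S)" if "S \<in> ?G k" for S k
  proof (rule finite_subset)
    show "?Q S \<subseteq> A \<times> A" using that by blast
  qed (use fin in simp)
  have ext: "(\<Sum>S\<in>?G k. if t ` S = S then c * rsign S t else 0) = c * ext_char A k t" for k c
    unfolding ext_char_def sum_distrib_left
    by (intro sum.mono_neutral_cong_right fG) auto
  have tr: "?r S u u = rsign S t" for S u by (rule rsign_cong) simp
  have tin: "t y = t z \<longleftrightarrow> y = z" for y z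
    using permutes_inj[OF t] by (simp add: inj_eq)

  \<comment> \<open>This side is the trace of t with D W, and \<open>2\<close> is the trace with W
    D. The bijection that follows equates \<open>1\<close> in degree k with \<open>2\<close> in
    degree k + 1.\<close>
  have 1: "(\<Sum>S\<in>?G k. \<Sum>(u, v)\<in>?P S. ?e u v * ?r S u v)
      = of_nat (card A - k) * ext_char A k t - near_sum A k t" for k
  proof -
    have "(\<Sum>(u, v)\<in>?P S. ?e u v * ?r S u v)
      = (if t ` S = S then of_nat (card A - k) * rsign S t else 0)
        - (\<Sum>(u, v)\<in>near_pairs A t S. ?r S u v)" if S: "S \<in> ?G k" for S
    proof -
      let ?D = "(\<lambda>v. (v, v)) ` {v \<in> A - S. t ` S = S}"
      have fS: "finite S" using S fin finite_subset by blast
      have fN: "finite (near_pairs A t S)" using S fin by (simp add: finite_near_pairs)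
      have fD: "finite ?D" using fin fS by simp
      have "(u, v) \<in> ?P S \<longleftrightarrow> (u, v) \<in> ?D \<union> near_pairs A t S" for u v
      proof -
        have "insert v S - {u} = (if u = v then S else insert v (S - {u}))" if "v \<notin> S"
          using that by auto
        then show ?thesis
          by (cases "u = v"; cases "v \<in> S") (simp_all add: near_pairs_def image_iff conj_ac)
      qed
      then have "?P S = ?D \<union> near_pairs A t S" by (rule rel_eqI)
      moreover have "?D \<inter> near_pairs A t S = {}"
        by (auto simp: near_pairs_def)
      ultimately have "(\<Sum>(u, v)\<in>?P S. ?e u v * ?r S u v)
        = (\<Sum>(u, v)\<in>?D. ?e u v * ?r S u v) + (\<Sum>(u, v)\<in>near_pairs A t S. ?e u v * ?r S u v)"
        using fN fD by (simp only: sum.union_disjoint)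
      also have "(\<Sum>(u, v)\<in>near_pairs A t S. ?e u v * ?r S u v)
        = - (\<Sum>(u, v)\<in>near_pairs A t S. ?r S u v)"
        unfolding sum_negf[symmetric] by (rule sum.cong) (auto simp: near_pairs_def)
      also have "(\<Sum>(u, v)\<in>?D. ?e u v * ?r S u v) = (\<Sum>v | v \<in> A - S \<and> t ` S = S. rsign S t)"
        by (subst sum.reindex) (auto simp: inj_on_def tr intro!: sum.cong)
      also have "\<dots> = (if t ` S = S then of_nat (card A - k) * rsign S t else 0)"
        using S fS fin by (auto simp: card_Diff_subset set_diff_eq[symmetric])
      finally show ?thesis by (simp only: diff_conv_add_uminus)
    qed
    then show ?thesis
      by (simp add: sum_subtractf ext near_sum_def)
  qed
  have 2: "(\<Sum>S\<in>?G k. \<Sum>(u, w)\<in>?Q S. ?r S u w)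
      = of_nat k * ext_char A k t + near_sum A k t" for k
  proof -
    have "(\<Sum>(u, w)\<in>?Q S. ?r S u w)
      = (if t ` S = S then of_nat k * rsign S t else 0)
        + (\<Sum>(u, v)\<in>near_pairs A t S. ?r S u v)" if S: "S \<in> ?G k" for S
    proof -
      let ?D = "(\<lambda>v. (v, v)) ` {v \<in> S. t ` S = S}"
      have fS: "finite S" using S fin finite_subset by blast
      have fN: "finite (near_pairs A t S)" using S fin by (simp add: finite_near_pairs)
      have fD: "finite ?D" using fin fS by simp
      have "(u, v) \<in> ?Q S \<longleftrightarrow> (u, v) \<in> ?D \<union> near_pairs A t S" for u v
        using S by (cases "u = v"; cases "u \<in> S")
          (auto simp: near_pairs_def image_iff insert_absorb cong: conj_cong)
      then have "?Q S = ?D \<union> near_pairs A t S" by (rule rel_eqI)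
      moreover have "?D \<inter> near_pairs A t S = {}"
        by (auto simp: near_pairs_def)
      ultimately have "(\<Sum>(u, v)\<in>?Q S. ?r S u v)
        = (\<Sum>(u, v)\<in>?D. ?r S u v) + (\<Sum>(u, v)\<in>near_pairs A t S. ?r S u v)"
        using fN fD by (simp only: sum.union_disjoint)
      also have "(\<Sum>(u, v)\<in>?D. ?r S u v) = (\<Sum>v | v \<in> S \<and> t ` S = S. rsign S t)"
        by (subst sum.reindex) (auto simp: inj_on_def tr intro!: sum.cong)
      also have "\<dots> = (if t ` S = S then of_nat k * rsign S t else 0)"
        using S by auto
      finally show ?thesis .
    qed
    then show ?thesis
      by (simp add: sum.distrib ext near_sum_def)
  qed
  have "(\<Sum>S\<in>?G k. \<Sum>(u, v)\<in>?P S. ?e u v * ?r S u v)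
      = (\<Sum>(S, u, v)\<in>Sigma (?G k) ?P. ?e u v * ?r S u v)"
    using fG fP by (subst sum.Sigma) (auto simp: case_prod_unfold)
  also have "\<dots> = (\<Sum>(S, u, w)\<in>Sigma (?G (Suc k)) ?Q. ?r S u w)"
  \<comment> \<open>The arc leads from u to v. Once v has joined S, the set is left at
    \<open>t v\<close>; if \<open>t v\<close> is u, the arc has closed up and the new set is stable
    with marked point u.\<close>
  proof (rule sum.reindex_bij_witness[where i = "\<lambda>(S, u, w). (S - {inv t w}, u, inv t w)"
        and j = "\<lambda>(S, u, v). (insert v S, u, t v)"], goal_cases)
    case (1 a)
    then show ?case by (auto simp: permutes_inverses[OF t])
  next
    case (2 a)
    then obtain S u v where a: "a = (S, u, v)" "S \<subseteq> A" "card S = k" "v \<in> A" "v \<notin> S"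
      "u \<in> insert v S" "t ` S = insert v S - {u}" by auto
    have "t v \<notin> insert v S - {u}" using a by (auto simp flip: a(7) simp: tin)
    moreover have "t v \<in> A" using a t by (simp add: permutes_in_image)
    moreover have "finite S" using a fin finite_subset by blast
    ultimately show ?case using a by auto
  next
    case (3 b)
    then obtain S u w where b: "b = (S, u, w)" "S \<subseteq> A" "card S = Suc k" "u \<in> S"
      "w \<in> A" "w \<notin> S - {u}" "t ` S = insert w (S - {u})" by auto
    have "inv t w \<in> S"
      using b(7) by (metis imageE insertI1 permutes_inverses(2)[OF t])
    then show ?case using b by (auto simp: permutes_inverses[OF t])
  next
    case (4 b)
    then obtain S u w where b: "b = (S, u, w)" "S \<subseteq> A" "card S = Suc k" "u \<in> S"
      "w \<in> A" "w \<notin> S - {u}" "t ` S = insert w (S - {u})" by auto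
    have w: "inv t w \<in> S"
      using b(7) by (metis imageE insertI1 permutes_inverses(2)[OF t])
    have "t ` (S - {inv t w}) = t ` S - {w}"
      by (auto simp: permutes_inverses[OF t] tin)
    also have "\<dots> = S - {u}" using b by auto
    also have "\<dots> = insert (inv t w) (S - {inv t w}) - {u}" using w by auto
    finally show ?case using b w fin finite_subset[OF b(2) fin] by auto
  next
    case (5 a)
    then obtain S u v where a: "a = (S, u, v)" "S \<subseteq> A" "card S = k" "v \<in> A" "v \<notin> S"
      "u \<in> insert v S" "t ` S = insert v S - {u}" by auto
    let ?S = "insert v S"
    let ?p = "restrict_id (transpose u v \<circ> t) S"
    have fS: "finite S" using a fin finite_subset by blast
    have tv: "t v \<notin> insert v S - {u}" using a by (auto simp flip: a(7) simp: tin)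
    have "(transpose u v \<circ> t) ` S = transpose u v ` (insert v S - {u})"
      by (metis a(7) image_comp)
    also have "\<dots> = S"
    proof (cases "u = v")
      case True
      then show ?thesis using a by auto
    next
      case False
      then have "insert v S - {u} = insert v (S - {u})" by auto
      moreover have "transpose u v ` (S - {u}) = S - {u}" using a by (force simp: transpose_def)
      ultimately show ?thesis using a False by auto
    qed
    finally have "?p permutes S" using fS by (intro restrict_id_permutes)
    then have p: "?p permutes ?S" by (rule permutes_imp_permutes_insert)
    \<comment> \<open>On S the two transpositions (u v) cancel and leave t; the point v is fixed by
      \<open>?p\<close> and then goes to u. The sign of the extra (u v) is the \<open>?e\<close> of
      the claim.\<close>
    have "transpose u (t v) (t y) = (transpose u v \<circ> ?p) y" if "y \<in> ?S" for y
    proof (cases "y = v")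
      case True
      then show ?thesis using a by simp
    next
      case False
      then have y: "y \<in> S" using that by simp
      then have "t y \<in> insert v S - {u}" using a(7) by blast
      then have "t y \<noteq> u" "t y \<noteq> t v" using tv by auto
      then show ?thesis using y by simp
    qed
    then have "?r ?S u (t v) = rsign ?S (transpose u v \<circ> ?p)"
      by (intro rsign_cong) simp
    also have "\<dots> = rsign ?S (transpose u v) * rsign ?S ?p"
      using fS permutes_image[OF p] permutes_image[OF permutes_swap_id[OF a(6) insertI1]]
      by (intro rsign_comp) (simp_all only: finite_insert)
    also have "rsign ?S ?p = ?r S u v"
      using p by (simp only: rsign_permutes) (simp only: rsign_def)
    also have "rsign ?S (transpose u v) = ?e u v"
      using a(6) by (intro rsign_transpose) auto
    finally show ?case using a(1) by (simp only: a(1) prod.case)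
  qed
  also have "\<dots> = (\<Sum>S\<in>?G (Suc k). \<Sum>(u, w)\<in>?Q S. ?r S u w)"
    using fG fQ by (subst sum.Sigma) (auto simp: case_prod_unfold)
  finally show ?thesis unfolding 1 2 by (simp add: algebra_simps)
qed

text \<open>The exterior power of degree k + 1 splits into the hooks with legs k and k + 1;
  \<open>near_sum_Suc\<close> eliminates the near sums.\<close>

lemma hook_char_Suc:
  assumes "finite A" "t permutes A" "k < card A"
  shows "hook_char A k t + hook_char A (Suc k) t = of_nat (card A) * ext_char A (Suc k) t"
proof -
  have "of_nat (card A) = of_nat (card A - Suc k) + (of_nat (Suc k) :: complex)"
    using assms(3) by (simp flip: of_nat_add)
  then show ?thesis
    using near_sum_Suc[OF assms(1,2), of k] by (simp add: hook_char_def algebra_simps)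
qed

text \<open>The product of \<open>x + c\<close> over the contents \<open>c = -k, \<dots>, n - k - 1\<close> of the hook.\<close>

definition hook_content :: "nat \<Rightarrow> nat \<Rightarrow> complex \<Rightarrow> complex" where
  "hook_content n k x = (\<Prod>i<k. x - 1 - of_nat i) * (\<Prod>i<n - k. x + of_nat i)"

text \<open>Induction through \<open>hook_char_Suc\<close>: in the convolution of the exterior
  character the part belonging to leg k has coefficient \<open>hook_content\<close> for k and
  cancels against the induction hypothesis, which leaves leg k + 1.\<close>

lemma convolution_hook_char:
  assumes fin: "finite A" and t: "t permutes A" and x: "x \<noteq> 0" and k: "k < card A"
  shows "(\<Sum>s | s permutes A. x ^ ncyc A s * hook_char A k (s \<circ> t))
    = hook_content (card A) k x * hook_char A k t"
  using k
proof (induction k)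
  case 0
  then show ?case
    using fin by (simp add: hook_char_0 hook_content_def sum_power_ncyc flip: sum_distrib_right)
next
  case (Suc k)
  let ?n = "card A"
  let ?h = "(\<Prod>i<k. x - 1 - of_nat i) * (\<Prod>i<?n - Suc k. x + of_nat i)"
  have "?n - k = Suc (?n - Suc k)" using Suc.prems by simp
  then have hk: "hook_content ?n k x = ?h * (x + of_nat (?n - Suc k))"
    by (simp add: hook_content_def mult.assoc)
  have hk': "hook_content ?n (Suc k) x = ?h * (x - of_nat (Suc k))"
    by (simp add: hook_content_def mult_ac algebra_simps)
  have perm: "s \<circ> t permutes A" if "s permutes A" for s using that t permutes_compose by blast
  have "(\<Sum>s | s permutes A. x ^ ncyc A s * hook_char A (Suc k) (s \<circ> t))
    = of_nat ?n * (\<Sum>s | s permutes A. x ^ ncyc A s * ext_char A (Suc k) (s \<circ> t))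
      - (\<Sum>s | s permutes A. x ^ ncyc A s * hook_char A k (s \<circ> t))"
    unfolding sum_distrib_left sum_subtractf[symmetric]
  proof (intro sum.cong refl)
    fix s assume "s \<in> {s. s permutes A}"
    then have "hook_char A (Suc k) (s \<circ> t) = of_nat ?n * ext_char A (Suc k) (s \<circ> t) - hook_char A k (s \<circ> t)"
      using hook_char_Suc[OF fin perm, of s k] Suc.prems by (simp add: algebra_simps)
    then show "x ^ ncyc A s * hook_char A (Suc k) (s \<circ> t)
        = of_nat ?n * (x ^ ncyc A s * ext_char A (Suc k) (s \<circ> t)) - x ^ ncyc A s * hook_char A k (s \<circ> t)"
      by (simp only:) (simp add: algebra_simps)
  qed
  also have "(\<Sum>s | s permutes A. x ^ ncyc A s * hook_char A k (s \<circ> t))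
    = hook_content ?n k x * hook_char A k t"
    using Suc.prems by (intro Suc.IH) simp
  also have "of_nat ?n * (\<Sum>s | s permutes A. x ^ ncyc A s * ext_char A (Suc k) (s \<circ> t))
    = ?h * ((x + of_nat (?n - Suc k)) * (of_nat ?n * ext_char A (Suc k) t) - of_nat ?n * hook_char A (Suc k) t)"
    unfolding convolution_ext_char[OF fin t x] hook_char_def by (simp add: algebra_simps)
  also have "of_nat ?n * ext_char A (Suc k) t = hook_char A k t + hook_char A (Suc k) t"
    using hook_char_Suc[OF fin t, of k] Suc.prems by simp
  also have "?h * ((x + of_nat (?n - Suc k)) * (hook_char A k t + hook_char A (Suc k) t) - of_nat ?n * hook_char A (Suc k) t)
     - hook_content ?n k x * hook_char A k t
    = ?h * ((x + of_nat (?n - Suc k)) - of_nat ?n) * hook_char A (Suc k) t"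
    unfolding hk by (simp add: algebra_simps)
  also have "\<dots> = hook_content ?n (Suc k) x * hook_char A (Suc k) t"
    using Suc.prems unfolding hk' by (simp add: of_nat_diff)
  finally show ?case .
qed

section \<open>Cycle types and products with a long cycle\<close>

text \<open>The determinant of 1 - X P for a permutation matrix P of cycle type \<mu>.\<close>

definition cycle_poly :: "nat multiset \<Rightarrow> complex poly" where
  "cycle_poly \<mu> = (\<Prod>l\<in>#\<mu>. 1 - [:0, 1:] ^ l)"

definition ctype :: "'a set \<Rightarrow> ('a \<Rightarrow> 'a) \<Rightarrow> nat multiset" where
  "ctype A t = image_mset card (mset_set (orbit t ` A))"

lemma Union_orbits:
  assumes "permutation t" "t ` S \<subseteq> S"
  shows "\<Union> (orbit t ` S) = S"
  using assms orbit_subset_invariant[of _ S t] permutation_self_in_orbit[OF assms(1)] by fast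

lemma disjoint_orbits: "permutation t \<Longrightarrow> pairwise disjnt (orbit t ` A)"
  unfolding pairwise_def disjnt_def by (metis disjoint_iff imageE orbit_eq_of_mem)

lemma finite_orbits:
  assumes "finite A" "t permutes A" "c \<in> orbit t ` A"
  shows "finite c"
  using assms permutes_orbit_subset finite_subset by (metis imageE)

text \<open>Stable subsets are the unions of sets U of cycles. Such a U is a choice of factors in
  the expanded product; its term has sign \<open>(-1) ^ card U\<close>, and t has sign
  \<open>(-1) ^ (k + card U)\<close> on the union.\<close>

lemma coeff_cycle_poly:
  assumes fin: "finite A" and t: "t permutes A"
  shows "coeff (cycle_poly (ctype A t)) k = (-1) ^ k * ext_char A k t"
proof -
  let ?C = "orbit t ` A"
  have p: "permutation t" using fin t permutation_permutes by blast
  have fC: "finite ?C" using fin by simp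
  have fU: "finite U" if "U \<subseteq> ?C" for U using that fC finite_subset by blast
  have "cycle_poly (ctype A t) = (\<Prod>c\<in>?C. - ([:0, 1:] ^ card c) + 1)"
    by (simp add: cycle_poly_def ctype_def image_mset.compositionality comp_def prod_unfold_prod_mset)
  also have "\<dots> = (\<Sum>U\<in>Pow ?C. (\<Prod>c\<in>U. - ([:0, 1:] ^ card c)))"
    by (subst prod_add[OF fC]) simp
  also have "\<dots> = (\<Sum>U\<in>Pow ?C. monom ((-1) ^ card U) (sum card U))"
  proof (intro sum.cong refl)
    fix U :: "'a set set"
    have "(-1 :: complex poly) ^ card U = [:(-1) ^ card U:]"
      by (simp add: poly_const_pow[symmetric] one_pCons)
    then show "(\<Prod>c\<in>U. - ([:0, 1:] ^ card c)) = monom ((-1 :: complex) ^ card U) (sum card U)"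
      by (simp add: prod_uminus power_sum[symmetric] monom_altdef)
  qed
  finally have "coeff (cycle_poly (ctype A t)) k = (\<Sum>U\<in>Pow ?C. if sum card U = k then (-1) ^ card U else 0)"
    by (simp add: coeff_sum)
  also have "\<dots> = (\<Sum>U | U \<subseteq> ?C \<and> sum card U = k. (-1) ^ card U)"
    using fC by (intro sum.mono_neutral_cong_right) auto
  also have "\<dots> = (\<Sum>S | S \<subseteq> A \<and> card S = k \<and> t ` S = S. (-1) ^ k * rsign S t)"
  proof -
    have orbs: "orbit t ` \<Union> U = U" if U: "U \<subseteq> ?C" for U
    proof (intro equalityI subsetI)
      fix c assume "c \<in> orbit t ` \<Union> U"
      then obtain x d where x: "c = orbit t x" "x \<in> d" "d \<in> U" by auto
      then obtain y where "d = orbit t y" using U by blast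
      then show "c \<in> U" using x orbit_eq_of_mem[OF p, of x y] by simp
    next
      fix c assume c: "c \<in> U"
      then obtain x where x: "c = orbit t x" using U by auto
      then have "x \<in> \<Union> U" using c permutation_self_in_orbit[OF p] by auto
      then show "c \<in> orbit t ` \<Union> U" using x by simp
    qed
    have card: "card (\<Union> U) = sum card U" if "U \<subseteq> ?C" for U
      using that pairwise_subset[OF disjoint_orbits[OF p]] finite_orbits[OF fin t]
      by (intro card_Union_disjoint) auto
    have sub: "\<Union> U \<subseteq> A" if "U \<subseteq> ?C" for U
      using that permutes_orbit_subset[OF t] by fastforce
    have stable: "t ` \<Union> U = \<Union> U" if U: "U \<subseteq> ?C" for U
    proof -
      have "t ` \<Union> U \<subseteq> \<Union> U"
      proof
        fix y assume "y \<in> t ` \<Union> U"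
        then obtain x d where x: "y = t x" "x \<in> d" "d \<in> U" by auto
        then obtain z where "d = orbit t z" using U by blast
        then show "y \<in> \<Union> U" using x orbit.step[of x t z] by blast
      qed
      then show ?thesis
        using finite_subset[OF sub[OF U] fin] permutes_inj_on[OF t]
        by (intro card_subset_eq) (auto simp: card_image)
    qed
    have inv: "\<Union> (orbit t ` S) = S" if "t ` S = S" for S
      using Union_orbits[OF p, of S] that by simp
    show ?thesis
    proof (rule sum.reindex_bij_witness[where i = "\<lambda>S. orbit t ` S" and j = Union], goal_cases)
      case (1 U)
      then show ?case using orbs by simp
    next
      case (2 U)
      then show ?case using card sub stable by simp
    next
      case (3 S)
      then show ?case using inv by simp
    next
      case (4 S)
      then have "orbit t ` S \<subseteq> ?C" by auto
      then show ?case using 4 card[of "orbit t ` S"] inv[of S] by simp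
    next
      case (5 U)
      then have U: "U \<subseteq> ?C" "card (\<Union> U) = k" using card by auto
      have "rsign (\<Union> U) t = (-1) ^ (k + card U)"
        using rsign_eq_ncyc[OF finite_subset[OF sub[OF U(1)] fin] stable[OF U(1)]] U orbs
        by (simp add: ncyc_def)
      then show ?case by (simp add: power_add flip: power_mult_distrib)
    qed
  qed
  finally show ?thesis by (simp add: ext_char_def sum_distrib_left)
qed

text \<open>With alternating signs \<open>hook_char_Suc\<close> says that multiplication by 1 - X
  turns the hook characters into \<open>card A\<close> times the exterior ones, whose generating
  polynomial is \<open>cycle_poly\<close>.\<close>

lemma hook_char_eq_coeff:
  assumes fin: "finite A" and t: "t permutes A"
    and g: "cycle_poly (ctype A t) = [:1, -1:] * g" and k: "k < card A"
  shows "(-1) ^ k * hook_char A k t = of_nat (card A) * coeff g k"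
  using k
proof (induction k)
  case 0
  have "coeff ([:1, -1:] * g) 0 = coeff g 0" by simp
  then show ?case
    using coeff_cycle_poly[OF fin t, of 0] by (simp add: g hook_char_0[OF fin] ext_char_0[OF fin])
next
  case (Suc k)
  have "coeff g (Suc k) - coeff g k = coeff ([:1, -1:] * g) (Suc k)" by simp
  also have "\<dots> = (-1) ^ Suc k * ext_char A (Suc k) t"
    using coeff_cycle_poly[OF fin t, of "Suc k"] by (simp only: g)
  finally have "of_nat (card A) * (coeff g (Suc k) - coeff g k)
    = (-1) ^ Suc k * (of_nat (card A) * ext_char A (Suc k) t)"
    by (simp only:) (simp only: mult.left_commute)
  also have "of_nat (card A) * ext_char A (Suc k) t = hook_char A k t + hook_char A (Suc k) t"
    using hook_char_Suc[OF fin t, of k] Suc.prems by simp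
  finally have "of_nat (card A) * coeff g (Suc k)
    = of_nat (card A) * coeff g k - (-1) ^ k * hook_char A k t - (-1) ^ k * hook_char A (Suc k) t"
    by (simp add: algebra_simps)
  then show ?case using Suc by simp
qed

text \<open>The case \<open>0 ^ 0 = 1\<close> of no parts matters: it is what remains of a single
  part once that part is split off.\<close>

lemma poly_cycle_poly_one: "poly (cycle_poly \<mu>) 1 = 0 ^ size \<mu>"
  by (induction \<mu>) (simp_all add: cycle_poly_def)

lemma degree_cycle_poly: "0 \<notin># \<mu> \<Longrightarrow> cycle_poly \<mu> \<noteq> 0 \<and> degree (cycle_poly \<mu>) = sum_mset \<mu>"
proof (induction \<mu>)
  case empty
  then show ?case by (simp add: cycle_poly_def)
next
  case (add l \<mu>)
  then have l: "l > 0" by auto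
  have eq: "(1 - [:0, 1:] ^ l :: complex poly) = monom (-1) l + 1"
    by (simp add: monom_altdef)
  have "degree (monom (-1) l + 1 :: complex poly) = l"
    using l by (subst degree_add_eq_left) (simp_all add: degree_monom_eq)
  moreover from this have "(monom (-1) l + 1 :: complex poly) \<noteq> 0"
    using l by (metis degree_0 less_numeral_extra(3))
  moreover have "cycle_poly (add_mset l \<mu>) = (monom (-1) l + 1) * cycle_poly \<mu>"
    by (simp add: cycle_poly_def eq)
  ultimately show ?case using add by (simp add: degree_mult_eq)
qed

lemma roots_cycle_poly:
  assumes "0 \<notin># \<mu>" "poly (cycle_poly \<mu>) u = 0"
  shows "norm u = 1"
proof -
  have "(\<Prod>l\<in>#\<mu>. 1 - u ^ l) = 0"
    using assms(2) by (simp add: cycle_poly_def poly_prod_mset)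
  then obtain l where l: "l \<in># \<mu>" "u ^ l = 1" by (auto simp: prod_mset_zero_iff)
  then have "l > 0" using assms(1) by (metis gr0I)
  then show ?thesis using power_eq_1_iff[OF l(2)] by simp
qed

text \<open>Dividing 1 - X out of the factor of one part l leaves 1 + X + ... + X^(l-1), with value
  l at 1; any further part makes the quotient vanish at 1.\<close>

lemma cycle_poly_quotient:
  assumes "\<mu> \<turnstile> n" "n > 0"
  obtains g where "cycle_poly \<mu> = [:1, -1:] * g" "degree g = n - 1" "g \<noteq> 0"
    "\<And>u. poly g u = 0 \<Longrightarrow> norm u = 1" "poly g 1 = (if size \<mu> = 1 then of_nat n else 0)"
proof -
  have \<mu>: "0 \<notin># \<mu>" "sum_mset \<mu> = n" using assms(1) by (auto simp: is_partition_def)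
  then have "\<mu> \<noteq> {#}" using assms(2) by auto
  then obtain l \<nu> where l: "\<mu> = add_mset l \<nu>" by (metis multiset_cases)
  define g :: "complex poly" where "g = (\<Sum>i<l. [:0, 1:] ^ i) * cycle_poly \<nu>"
  have 11: "1 - [:0, 1:] = ([:1, -1:] :: complex poly)" by (simp add: one_pCons)
  have g: "cycle_poly \<mu> = [:1, -1:] * g"
    unfolding g_def l by (simp only: cycle_poly_def image_mset_add_mset prod_mset.add_mset
        one_diff_power_eq 11 mult.assoc)
  have nz: "cycle_poly \<mu> \<noteq> 0" and deg: "degree (cycle_poly \<mu>) = n"
    using degree_cycle_poly[OF \<mu>(1)] \<mu>(2) by auto
  have g0: "g \<noteq> 0" using g nz by auto
  have "n = Suc (degree g)"
    using deg g0 unfolding g by (subst (asm) degree_mult_eq) auto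
  moreover have "norm u = 1" if "poly g u = 0" for u
    using that roots_cycle_poly[OF \<mu>(1), of u] by (simp add: g)
  moreover have "poly g 1 = (if size \<mu> = 1 then of_nat n else 0)"
    using \<mu>(2) unfolding g_def l
    by (cases "\<nu> = {#}") (simp_all add: poly_cycle_poly_one poly_sum flip: size_eq_0_iff_empty)
  ultimately show ?thesis using that g g0 by auto
qed

lemma ctype_partition:
  assumes "finite A" "t permutes A"
  shows "ctype A t \<turnstile> card A"
proof -
  have p: "permutation t" using assms permutation_permutes by blast
  have "\<Union> (orbit t ` A) = A"
    using Union_orbits[OF p] permutes_image[OF assms(2)] by auto
  then have "card A = sum card (orbit t ` A)"
    using card_Union_disjoint[OF disjoint_orbits[OF p] finite_orbits[OF assms]] by metis
  moreover have "0 \<notin> card ` orbit t ` A"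
    using finite_orbits[OF assms] orbit_nonempty[of t] by (auto simp: card_eq_0_iff)
  ultimately show ?thesis
    using assms(1) by (simp add: is_partition_def ctype_def sum_unfold_sum_mset)
qed

lemma size_ctype: "finite A \<Longrightarrow> size (ctype A t) = ncyc A t"
  by (simp add: ctype_def ncyc_def)

lemma cyclic_on_iff_ncyc:
  assumes "finite A" "t permutes A"
  shows "cyclic_on t A \<longleftrightarrow> ncyc A t = 1"
proof
  assume "cyclic_on t A"
  then have "A \<noteq> {}" "\<forall>x\<in>A. orbit t x = A" by (auto simp: cyclic_on_alldef)
  then have "orbit t ` A = {A}" by auto
  then show "ncyc A t = 1" by (simp add: ncyc_def)
next
  assume "ncyc A t = 1"
  then obtain c where c: "orbit t ` A = {c}" by (auto simp: ncyc_def card_1_singleton_iff)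
  have p: "permutation t" using assms permutation_permutes by blast
  have "\<Union> (orbit t ` A) = A"
    using Union_orbits[OF p] permutes_image[OF assms(2)] by auto
  then have "c = A" using c by simp
  moreover obtain x where "x \<in> A" using c by auto
  ultimately show "cyclic_on t A" using c unfolding cyclic_on_def by blast
qed

text \<open>The sum is \<open>card A\<close> times the sum of the coefficients of g, and the value
  of g at 1 detects a single cycle.\<close>

lemma alternating_sum_hook_char:
  assumes fin: "finite A" and ne: "A \<noteq> {}" and t: "t permutes A"
  shows "(\<Sum>k<card A. (-1) ^ k * hook_char A k t) = (if cyclic_on t A then of_nat (card A) ^ 2 else 0)"
proof -
  let ?n = "card A"
  have n: "?n > 0" using fin ne by (simp add: card_gt_0_iff)
  obtain g where g: "cycle_poly (ctype A t) = [:1, -1:] * g" "degree g = ?n - 1"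
    "poly g 1 = (if size (ctype A t) = 1 then of_nat ?n else 0)"
    using cycle_poly_quotient[OF ctype_partition[OF fin t] n] by metis
  have "{..<?n} = {..degree g}" using g(2) n by auto
  then have "(\<Sum>k<?n. coeff g k) = poly g 1" by (simp add: poly_altdef)
  moreover have "(\<Sum>k<?n. (-1) ^ k * hook_char A k t) = of_nat ?n * (\<Sum>k<?n. coeff g k)"
    by (simp add: hook_char_eq_coeff[OF fin t g(1)] sum_distrib_left)
  ultimately show ?thesis
    by (simp add: g(3) size_ctype[OF fin] cyclic_on_iff_ncyc[OF fin t] power2_eq_square)
qed

section \<open>Convolution over lists of permutations\<close>

definition perm_lists :: "'a set \<Rightarrow> nat \<Rightarrow> ('a \<Rightarrow> 'a) list set" where
  "perm_lists A m = {ts. length ts = m \<and> (\<forall>s\<in>set ts. s permutes A)}"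

lemma finite_perm_lists: "finite A \<Longrightarrow> finite (perm_lists A m)"
  unfolding perm_lists_def
  using finite_lists_length_eq[OF finite_permutations, of A m]
  by (rule finite_subset[rotated]) auto

lemma foldr_permutes: "\<forall>s\<in>set ts. s permutes A \<Longrightarrow> foldr (\<circ>) ts id permutes A"
proof (induction ts)
  case (Cons s ts)
  then have "s \<circ> foldr (\<circ>) ts id permutes A" by (metis list.set_intros permutes_compose)
  moreover have "foldr (\<circ>) (s # ts) id = s \<circ> foldr (\<circ>) ts id" by (simp only: foldr.simps comp_apply)
  ultimately show ?case by (simp only:)
qed simp

lemma iterated_convolution:
  assumes eig: "\<And>t. t permutes A \<Longrightarrow> (\<Sum>s | s permutes A. w s * F (s \<circ> t)) = c * F t"
    and t: "t permutes A"
  shows "(\<Sum>ts\<in>perm_lists A m. prod_list (map w ts) * F (foldr (\<circ>) ts id \<circ> t)) = c ^ m * (F t :: complex)"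
proof (induction m)
  case 0
  have "perm_lists A 0 = {[]}" by (auto simp: perm_lists_def)
  then show ?case by simp
next
  case (Suc m)
  have im: "perm_lists A (Suc m) = (\<lambda>(ts, s). s # ts) ` (perm_lists A m \<times> {s. s permutes A})"
    by (auto simp: perm_lists_def length_Suc_conv image_iff)
  have "(\<Sum>ts\<in>perm_lists A (Suc m). prod_list (map w ts) * F (foldr (\<circ>) ts id \<circ> t))
    = (\<Sum>(ts, s)\<in>perm_lists A m \<times> {s. s permutes A}.
        prod_list (map w (s # ts)) * F (foldr (\<circ>) (s # ts) id \<circ> t))"
    unfolding im by (subst sum.reindex) (auto simp: inj_on_def case_prod_unfold)
  also have "\<dots> = (\<Sum>ts\<in>perm_lists A m. \<Sum>s | s permutes A.
        prod_list (map w ts) * (w s * F (s \<circ> (foldr (\<circ>) ts id \<circ> t))))"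
    by (simp add: sum.cartesian_product case_prod_unfold mult_ac comp_assoc)
  also have "\<dots> = (\<Sum>ts\<in>perm_lists A m. prod_list (map w ts) * (c * F (foldr (\<circ>) ts id \<circ> t)))"
  proof (intro sum.cong refl)
    fix ts assume "ts \<in> perm_lists A m"
    then have "foldr (\<circ>) ts id \<circ> t permutes A"
      using t by (intro permutes_compose foldr_permutes) (auto simp: perm_lists_def)
    from eig[OF this] show "(\<Sum>s | s permutes A. prod_list (map w ts) * (w s * F (s \<circ> (foldr (\<circ>) ts id \<circ> t))))
        = prod_list (map w ts) * (c * F (foldr (\<circ>) ts id \<circ> t))"
      by (simp flip: sum_distrib_left)
  qed
  also have "\<dots> = c * (c ^ m * F t)"
    unfolding Suc[symmetric] sum_distrib_left by (simp add: mult_ac)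
  finally show ?case by (simp only: power_Suc mult.assoc)
qed

text \<open>The indicator of long cycles is replaced by the alternating sum of hook characters, each
  multiplied by its eigenvalue in every convolution. Of the square of \<open>card A\<close> from the
  indicator, one factor cancels against that in \<open>hook_char_eq_coeff\<close>.\<close>

lemma sum_cyclic_products:
  assumes fin: "finite A" and ne: "A \<noteq> {}" and t: "t permutes A" and x: "x \<noteq> 0"
    and g: "cycle_poly (ctype A t) = [:1, -1:] * g"
  shows "of_nat (card A) * (\<Sum>ts | ts \<in> perm_lists A m \<and> cyclic_on (foldr (\<circ>) ts id \<circ> t) A.
      prod_list (map (\<lambda>s. x ^ ncyc A s) ts))
    = (\<Sum>k<card A. coeff g k * hook_content (card A) k x ^ m)"
proof -
  let ?n = "card A"
  let ?w = "\<lambda>ts. prod_list (map (\<lambda>s. x ^ ncyc A s) ts)"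
  let ?p = "\<lambda>ts. foldr (\<circ>) ts id \<circ> t"
  have n: "?n > 0" using fin ne by (simp add: card_gt_0_iff)
  have "(\<Sum>ts | ts \<in> perm_lists A m \<and> cyclic_on (?p ts) A. of_nat ?n ^ 2 * ?w ts)
    = (\<Sum>ts\<in>perm_lists A m. ?w ts * (if cyclic_on (?p ts) A then of_nat ?n ^ 2 else 0))"
    using finite_perm_lists[OF fin] by (intro sum.mono_neutral_cong_left) auto
  also have "\<dots> = (\<Sum>ts\<in>perm_lists A m. \<Sum>k<?n. ?w ts * ((-1) ^ k * hook_char A k (?p ts)))"
  proof (intro sum.cong refl)
    fix ts assume "ts \<in> perm_lists A m"
    then have "?p ts permutes A"
      using t by (intro permutes_compose foldr_permutes) (auto simp: perm_lists_def)
    from alternating_sum_hook_char[OF fin ne this]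
    show "?w ts * (if cyclic_on (?p ts) A then of_nat ?n ^ 2 else 0)
        = (\<Sum>k<?n. ?w ts * ((-1) ^ k * hook_char A k (?p ts)))"
      by (simp only: sum_distrib_left[symmetric])
  qed
  also have "\<dots> = (\<Sum>k<?n. (-1) ^ k * (\<Sum>ts\<in>perm_lists A m. ?w ts * hook_char A k (?p ts)))"
    by (subst sum.swap) (simp add: sum_distrib_left mult_ac)
  also have "\<dots> = (\<Sum>k<?n. ((-1) ^ k * hook_char A k t) * hook_content ?n k x ^ m)"
  proof (intro sum.cong refl)
    fix k assume "k \<in> {..<?n}"
    then have "(\<Sum>ts\<in>perm_lists A m. ?w ts * hook_char A k (?p ts)) = hook_content ?n k x ^ m * hook_char A k t"
      by (intro iterated_convolution convolution_hook_char fin x t) simp_all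
    then show "(-1) ^ k * (\<Sum>ts\<in>perm_lists A m. ?w ts * hook_char A k (?p ts))
        = ((-1) ^ k * hook_char A k t) * hook_content ?n k x ^ m"
      by (simp only: mult_ac)
  qed
  also have "\<dots> = (\<Sum>k<?n. of_nat ?n * (coeff g k * hook_content ?n k x ^ m))"
    by (intro sum.cong refl) (simp add: hook_char_eq_coeff[OF fin t g] mult.assoc)
  finally show ?thesis
    using n by (simp add: power2_eq_square mult.assoc flip: sum_distrib_left)
qed

section \<open>Permutations of a prescribed cycle type\<close>

lemma ex_cyclic_on:
  assumes "finite C" "C \<noteq> {}"
  shows "\<exists>q. q permutes C \<and> orbit q ` C = {C}"
  using assms
proof (induction C rule: finite_ne_induct)
  case (singleton a)
  have "orbit id a = {a}" by (simp add: orbit_eq_singleton_iff)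
  then show ?case by (intro exI[of _ id] conjI permutes_id) (simp only: image_insert image_empty)
next
  case (insert a C)
  then obtain q where q: "q permutes C" "orbit q ` C = {C}" by blast
  obtain b where b: "b \<in> C" using insert.hyps by blast
  have p: "permutation q" using insert.hyps q permutation_permutes by blast
  let ?q = "q \<circ> transpose b a"
  have Cb: "orbit q b = C" using q b by auto
  have "q a = a" using q insert.hyps by (simp add: permutes_not_in)
  then have a: "orbit q a = {a}" by (simp add: orbit_eq_singleton_iff)
  have perm: "?q permutes insert a C"
    using b q by (intro permutes_compose permutes_swap_id permutes_imp_permutes_insert) auto
  have pq: "permutation ?q" by (intro permutation_compose p permutation_swap_id)
  have "orbit ?q b = insert a C"
    using orbit_comp_transpose(1)[OF p, of a b] Cb a insert.hyps by auto
  then have "orbit ?q y = insert a C" if "y \<in> insert a C" for y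
    using that orbit_eq_of_mem[OF pq] by metis
  then have "orbit ?q ` insert a C = {insert a C}" by (auto simp only: image_iff)
  then show ?case using perm by blast
qed

text \<open>Makes the conjugacy class nonempty, so that its size can be cancelled in the final
  equation.\<close>

lemma ex_cycle_type:
  assumes "finite A" "\<mu> \<turnstile> card A"
  shows "\<exists>t. t permutes A \<and> ctype A t = \<mu>"
  using assms
proof (induction \<mu> arbitrary: A)
  case empty
  then have "A = {}" by (simp add: is_partition_def)
  then show ?case by (simp add: ctype_def)
next
  case (add l \<mu>)
  have l: "l > 0" "l + sum_mset \<mu> = card A" "0 \<notin># \<mu>" using add.prems by (auto simp: is_partition_def)
  then obtain C where C: "C \<subseteq> A" "card C = l" by (metis le_add1 obtain_subset_with_card_n)
  have fC: "finite C" using C add.prems finite_subset by blast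
  let ?B = "A - C"
  have "card ?B = sum_mset \<mu>" using C l fC by (simp add: card_Diff_subset)
  then obtain t where t: "t permutes ?B" "ctype ?B t = \<mu>"
    using add.IH[of ?B] add.prems l by (auto simp: is_partition_def)
  have "C \<noteq> {}" using C l by auto
  then obtain q where q: "q permutes C" "orbit q ` C = {C}" using ex_cyclic_on[OF fC] by blast
  let ?p = "t \<circ> q"
  have p1: "?p y = t y" "t y \<in> ?B" if "y \<in> ?B" for y
    using that permutes_not_in[OF q(1), of y] permutes_in_image[OF t(1), of y] by simp_all
  have p2: "?p y = q y" "q y \<in> C" if "y \<in> C" for y
    using that permutes_in_image[OF q(1), of y] permutes_not_in[OF t(1), of "q y"] by simp_all
  have "orbit ?p y = orbit t y" if "y \<in> ?B" for y
    using that p1 by (intro orbit_cong0[of y ?B]) auto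
  then have o1: "orbit ?p ` ?B = orbit t ` ?B" by (rule image_cong[OF refl])
  have "orbit ?p y = orbit q y" if "y \<in> C" for y
    using that p2 by (intro orbit_cong0[of y C]) auto
  then have o2: "orbit ?p ` C = {C}" using q(2) by (metis image_cong)
  have "A = C \<union> ?B" using C by auto
  then have "orbit ?p ` A = insert C (orbit t ` ?B)" using o1 o2 by (metis image_Un insert_is_Un)
  moreover have "C \<notin> orbit t ` ?B"
    using permutes_orbit_subset[OF t(1)] C l by (auto simp: card_gt_0_iff) blast
  moreover have "finite (orbit t ` ?B)" using add.prems by simp
  ultimately have "ctype A ?p = add_mset l \<mu>"
    using t(2) C by (simp add: ctype_def)
  moreover have "?p permutes A"
    using q t C by (intro permutes_compose) (auto intro: permutes_subset)
  ultimately show ?case by blast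
qed

section \<open>Zeros of shift operators\<close>

text \<open>The point x lies on the side of a of the perpendicular bisector of a and b.\<close>

lemma norm_shift_less:
  assumes "Re x > (Re a + Re b) / 2" "Im a = Im b" "Re b < Re a"
  shows "norm (x - a) < norm (x - b)"
proof -
  have "(Re x - Re a)\<^sup>2 < (Re x - Re b)\<^sup>2"
  proof -
    have "0 < (Re a - Re b) * (2 * Re x - Re a - Re b)"
      using assms by (intro mult_pos_pos) (auto simp: field_simps)
    then show ?thesis by (simp add: power2_eq_square algebra_simps)
  qed
  then show ?thesis using assms(2) by (simp add: cmod_def)
qed

lemma norm_shift_greater:
  assumes "Re x < (Re a + Re b) / 2" "Im a = Im b" "Re b < Re a"
  shows "norm (x - b) < norm (x - a)"
proof -
  have "(Re x - Re b)\<^sup>2 < (Re x - Re a)\<^sup>2"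
  proof -
    have "0 < (Re a - Re b) * (Re a + Re b - 2 * Re x)"
      using assms by (intro mult_pos_pos) (auto simp: field_simps)
    then show ?thesis by (simp add: power2_eq_square algebra_simps)
  qed
  then show ?thesis using assms(2) by (simp add: cmod_def)
qed

lemma poly_eq_prod_roots:
  fixes Q :: "complex poly"
  obtains root where "\<And>x. poly Q x = lead_coeff Q * (\<Prod>i<degree Q. x - root i)"
    and "Q \<noteq> 0 \<Longrightarrow> \<forall>i<degree Q. poly Q (root i) = 0"
proof -
  obtain root where r: "smult (lead_coeff Q) (\<Prod>i<degree Q. [:- root i, 1:]) = Q"
    by (rule complex_poly_decompose')
  have p: "poly Q x = lead_coeff Q * (\<Prod>i<degree Q. x - root i)" for x
    by (subst r[symmetric]) (simp add: poly_prod)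
  then have "\<forall>i<degree Q. poly Q (root i) = 0" by auto
  then show ?thesis using that p by blast
qed

text \<open>Each zero and its translate by 1 have the line \<open>Re x = c + 1 / 2\<close> as
  bisector, so all linear factors compare the same way. The inequalities are weak because Q may be
  constant.\<close>

lemma norm_poly_shift:
  assumes Q: "Q \<noteq> 0" and roots: "\<And>z. poly Q z = 0 \<Longrightarrow> Re z = c"
  shows "Re x > c + 1 / 2 \<Longrightarrow> norm (poly Q (x - 1)) \<le> norm (poly Q x)"
    and "Re x < c + 1 / 2 \<Longrightarrow> norm (poly Q x) \<le> norm (poly Q (x - 1))"
proof -
  obtain root where p: "\<And>x. poly Q x = lead_coeff Q * (\<Prod>i<degree Q. x - root i)"
    and "Q \<noteq> 0 \<Longrightarrow> \<forall>i<degree Q. poly Q (root i) = 0"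
    using poly_eq_prod_roots[of Q] by blast
  then have r: "Re (root i) = c" if "i < degree Q" for i using that roots Q by blast
  have n: "norm (poly Q y) = norm (lead_coeff Q) * (\<Prod>i<degree Q. norm (y - root i))" for y
    unfolding p norm_mult prod_norm ..
  show "norm (poly Q (x - 1)) \<le> norm (poly Q x)" if "Re x > c + 1 / 2"
    unfolding n
  proof (intro mult_left_mono prod_mono conjI)
    fix i assume "i \<in> {..<degree Q}"
    then have "norm (x - (root i + 1)) < norm (x - root i)"
      using r[of i] that by (intro norm_shift_less) (auto simp: field_simps)
    then show "norm (x - 1 - root i) \<le> norm (x - root i)" by (simp add: algebra_simps)
  qed auto
  show "norm (poly Q x) \<le> norm (poly Q (x - 1))" if "Re x < c + 1 / 2"
    unfolding n
  proof (intro mult_left_mono prod_mono conjI)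
    fix i assume "i \<in> {..<degree Q}"
    then have "norm (x - root i) < norm (x - (root i + 1))"
      using r[of i] that by (intro norm_shift_greater) (auto simp: field_simps)
    then show "norm (x - root i) \<le> norm (x - 1 - root i)" by (simp add: algebra_simps)
  qed auto
qed

text \<open>Off the line \<open>Re x = (1 - r) / 2\<close> the two terms have different absolute values.\<close>

lemma roots_step:
  fixes Q :: "complex poly" and r :: real
  assumes Q: "Q \<noteq> 0" and roots: "\<And>z. poly Q z = 0 \<Longrightarrow> Re z = - r / 2"
    and u: "norm u = 1" and m: "m > 0" and r: "r \<ge> 0"
    and x: "(x - 1) ^ m * poly Q (x - 1) = u * ((x + of_real r) ^ m * poly Q x)"
  shows "Re x = (1 - r) / 2"
proof (rule ccontr)
  assume "Re x \<noteq> (1 - r) / 2"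
  then consider "Re x > (1 - r) / 2" | "Re x < (1 - r) / 2" by linarith
  then show False
  proof cases
    case 1
    \<comment> \<open>The points 1 and -r have the same bisector as each zero of Q and its
      translate. As \<open>r \<ge> 0\<close> and \<open>m > 0\<close>, this factor supplies the
      strictness.\<close>
    then have "norm (x - 1) < norm (x - (- of_real r))"
      using r by (intro norm_shift_less) auto
    then have "norm (x - 1) ^ m < norm (x + of_real r) ^ m"
      using m by (intro power_strict_mono) auto
    moreover have "norm (poly Q (x - 1)) \<le> norm (poly Q x)"
      using 1 by (intro norm_poly_shift[OF Q roots]) (auto simp: field_simps)
    moreover have "poly Q x \<noteq> 0" using roots[of x] 1 by (auto simp: field_simps)
    ultimately have "norm (x - 1) ^ m * norm (poly Q (x - 1)) < norm (x + of_real r) ^ m * norm (poly Q x)"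
      by (intro order.strict_trans1[OF mult_left_mono mult_strict_right_mono]) auto
    then show False using arg_cong[OF x, of norm] u by (simp add: norm_mult norm_power)
  next
    case 2
    then have "norm (x - (- of_real r)) < norm (x - 1)"
      using r by (intro norm_shift_greater) auto
    then have "norm (x + of_real r) ^ m < norm (x - 1) ^ m"
      using m by (intro power_strict_mono) auto
    moreover have "norm (poly Q x) \<le> norm (poly Q (x - 1))"
      using 2 by (intro norm_poly_shift[OF Q roots]) (auto simp: field_simps)
    moreover have "poly Q (x - 1) \<noteq> 0" using roots[of "x - 1"] 2 by (auto simp: field_simps)
    ultimately have "norm (x + of_real r) ^ m * norm (poly Q x) < norm (x - 1) ^ m * norm (poly Q (x - 1))"
      by (intro order.strict_trans1[OF mult_left_mono mult_strict_right_mono]) auto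
    then show False using arg_cong[OF x, of norm] u by (simp add: norm_mult norm_power)
  qed
qed

section \<open>Polynomials in the shift and the zeros they produce\<close>

definition shift_op :: "complex poly \<Rightarrow> (complex \<Rightarrow> complex) \<Rightarrow> complex \<Rightarrow> complex" where
  "shift_op g f x = (\<Sum>k\<le>degree g. coeff g k * f (x - of_nat k))"

lemma shift_op_altdef:
  assumes "degree g \<le> N"
  shows "shift_op g f x = (\<Sum>k\<le>N. coeff g k * f (x - of_nat k))"
  unfolding shift_op_def using assms
  by (intro sum.mono_neutral_left) (auto simp: coeff_eq_0)

lemma shift_op_linear_factor:
  "shift_op ([:-u, 1:] * g) f x = shift_op g f (x - 1) - u * shift_op g f x"
proof -
  let ?N = "degree g"
  have "degree ([:-u, 1:] * g) \<le> Suc ?N"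
    using degree_mult_le[of "[:-u, 1:]" g] by simp
  then have "shift_op ([:-u, 1:] * g) f x
    = (\<Sum>k\<le>Suc ?N. coeff (pCons 0 g) k * f (x - of_nat k)) - u * (\<Sum>k\<le>Suc ?N. coeff g k * f (x - of_nat k))"
    unfolding shift_op_altdef[OF \<open>degree ([:-u, 1:] * g) \<le> Suc ?N\<close>]
    by (simp add: sum_subtractf sum_distrib_left algebra_simps)
  also have "(\<Sum>k\<le>Suc ?N. coeff (pCons 0 g) k * f (x - of_nat k)) = shift_op g f (x - 1)"
    unfolding sum.atMost_Suc_shift shift_op_def by (simp add: algebra_simps)
  also have "(\<Sum>k\<le>Suc ?N. coeff g k * f (x - of_nat k)) = shift_op g f x"
    by (rule shift_op_altdef[symmetric]) simp
  finally show ?thesis .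
qed

lemma shift_op_roots:
  assumes g: "g \<noteq> 0" and deg: "degree g < n" and unit: "\<And>u. poly g u = 0 \<Longrightarrow> norm u = 1"
    and m: "m > 0"
  obtains Q where "Q \<noteq> 0" "\<And>z. poly Q z = 0 \<Longrightarrow> Re z = - (real (n - 1 - degree g)) / 2"
    "\<And>x. shift_op g (\<lambda>x. (\<Prod>i<n. x + of_nat i) ^ m) x
      = (\<Prod>i<n - degree g. x + of_nat i) ^ m * poly Q x"
proof -
  let ?f = "\<lambda>x::complex. (\<Prod>i<n. x + of_nat i) ^ m"
  have "\<exists>Q. Q \<noteq> 0 \<and> (\<forall>z. poly Q z = 0 \<longrightarrow> Re z = - (real (n - 1 - degree g)) / 2) \<and>
    (\<forall>x. shift_op g ?f x = (\<Prod>i<n - degree g. x + of_nat i) ^ m * poly Q x)"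
    using g deg unit
  proof (induction "degree g" arbitrary: g)
    case 0
    then obtain c where c: "g = [:c:]" "c \<noteq> 0"
      by (metis degree_eq_zeroE pCons_0_0)
    then show ?case
      by (intro exI[of _ "[:c:]"]) (auto simp: shift_op_def mult.commute)
  next
    case (Suc d)
    have "\<not> constant (poly g)" using Suc(2) by (simp add: constant_degree)
    then obtain u where u: "poly g u = 0" using fundamental_theorem_of_algebra by blast
    then obtain h where h: "g = [:-u, 1:] * h" by (metis dvdE poly_eq_0_iff_dvd)
    have h0: "h \<noteq> 0" using h Suc.prems by auto
    have dh: "d = degree h" using Suc(2) h h0 by (simp add: degree_mult_eq del: mult_pCons_left)
    have dg: "degree g = Suc d" using Suc(2) by simp
    obtain Q where Q: "Q \<noteq> 0" "\<And>z. poly Q z = 0 \<Longrightarrow> Re z = - (real (n - 1 - d)) / 2"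
      "\<And>x. shift_op h ?f x = (\<Prod>i<n - d. x + of_nat i) ^ m * poly Q x"
      using Suc(1)[OF dh h0] Suc.prems dg h unfolding dh by auto
    \<comment> \<open>The forced zeros of the h-part are 0, ..., -r and move to 1, ..., -(r-1) under
      the shift. The common ones stay forced; the unmatched factors at 1 and -r go into
      \<open>Q'\<close>.\<close>
    define r where "r = n - 1 - d"
    have nd: "n - d = Suc r" "n - Suc d = r" and r1: "n - 1 - Suc d = r - 1" and rpos: "r > 0"
      using Suc.prems dg by (auto simp: r_def)
    define Q' where "Q' = [:-1, 1:] ^ m * pcompose Q [:-1, 1:] - smult u ([:of_nat r, 1:] ^ m * Q)"
    have Q'x: "poly Q' x = (x - 1) ^ m * poly Q (x - 1) - u * ((x + of_nat r) ^ m * poly Q x)" for x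
      by (simp add: Q'_def poly_pcompose algebra_simps)
    have roots: "Re x = (1 - real r) / 2" if "poly Q' x = 0" for x
    proof (rule roots_step[of Q "real r" u m x])
      show "norm u = 1" using Suc.prems u by blast
    qed (use Q m that in \<open>auto simp: Q'x r_def\<close>)
    \<comment> \<open>\<open>roots\<close> was proved before \<open>Q'\<close> is known to be
      nonzero, so any point off the line, such as n + 1, shows that it is.\<close>
    have "poly Q' (of_nat (Suc n)) \<noteq> 0" using roots[of "of_nat (Suc n)"] by (auto simp: field_simps)
    then have "Q' \<noteq> 0" by auto
    moreover have "shift_op g ?f x = (\<Prod>i<n - Suc d. x + of_nat i) ^ m * poly Q' x" for x
    proof -
      have sh: "(\<Prod>i<Suc r. x - 1 + of_nat i) = (x - 1) * (\<Prod>i<r. x + of_nat i)"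
        unfolding prod.lessThan_Suc_shift by (simp add: algebra_simps)
      show ?thesis
        unfolding h shift_op_linear_factor Q(3) nd sh Q'x
        unfolding prod.lessThan_Suc power_mult_distrib
        by (simp only: right_diff_distrib mult_ac)
    qed
    moreover have "Re z = - real (n - 1 - Suc d) / 2" if "poly Q' z = 0" for z
      using roots[OF that] rpos unfolding r1 by (simp add: of_nat_diff)
    ultimately show ?case unfolding dg by blast
  qed
  then show ?thesis using that by blast
qed

section \<open>Maps and the genus polynomial\<close>

lemma hook_content_eq:
  assumes "k \<le> n"
  shows "hook_content n k x = (\<Prod>i<n. x - of_nat k + of_nat i)"
proof -
  have split: "(\<Prod>i<k + j. f i) = (\<Prod>i<k. f i) * (\<Prod>i<j. f (k + i))" for f :: "nat \<Rightarrow> complex" and j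
    by (induction j) (simp_all add: mult.assoc)
  have "(\<Prod>i<k. x - of_nat k + of_nat i) = (\<Prod>i<k. x - of_nat k + of_nat (k - Suc i))"
    by (rule prod.nat_diff_reindex[symmetric])
  also have "\<dots> = (\<Prod>i<k. x - 1 - of_nat i)"
    by (intro prod.cong refl) (simp add: of_nat_diff)
  finally have 1: "(\<Prod>i<k. x - of_nat k + of_nat i) = (\<Prod>i<k. x - 1 - of_nat i)" .
  have "(\<Prod>i<k + (n - k). x - of_nat k + of_nat i) = hook_content n k x"
    unfolding split 1 hook_content_def by simp
  then show ?thesis using assms by simp
qed

lemma cycle_type_eq_ctype: "cycle_type n p = ctype {1..n} p"
  by (simp add: cycle_type_def cycles_def ctype_def)

section \<open>Cycle counts and signs of products of lists\<close>

lemma sum_list_ncyc_le: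
  assumes "finite A" "\<forall>s\<in>set ts. s permutes A"
  shows "sum_list (map (ncyc A) ts) + card A \<le> length ts * card A + ncyc A (foldr (\<circ>) ts id)"
  using assms(2)
proof (induction ts)
  case Nil
  show ?case by (simp add: ncyc_id[unfolded id_def])
next
  case (Cons s ts)
  have "foldr (\<circ>) ts id permutes A" by (rule foldr_permutes) (use Cons.prems in simp)
  then have "ncyc A s + ncyc A (foldr (\<circ>) ts id) \<le> card A + ncyc A (s \<circ> foldr (\<circ>) ts id)"
    using Cons.prems by (intro ncyc_comp_ge[OF assms(1) order_refl]) simp_all
  moreover have "foldr (\<circ>) (s # ts) id = s \<circ> foldr (\<circ>) ts id" by (simp only: foldr.simps comp_apply)
  ultimately have "ncyc A s + ncyc A (foldr (\<circ>) ts id) \<le> card A + ncyc A (foldr (\<circ>) (s # ts) id)"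
    by (simp only:)
  moreover have "sum_list (map (ncyc A) ts) + card A \<le> length ts * card A + ncyc A (foldr (\<circ>) ts id)"
    by (rule Cons.IH) (use Cons.prems in simp)
  ultimately show ?case
    unfolding list.map sum_list.Cons list.size mult_Suc add_Suc_right add_0_right by linarith
qed

lemma sign_foldr:
  assumes "finite A" "\<forall>s\<in>set ts. s permutes A"
  shows "sign (foldr (\<circ>) ts id) = (-1) ^ (length ts * card A + sum_list (map (ncyc A) ts))"
  using assms(2)
proof (induction ts)
  case Nil
  then show ?case by simp
next
  case (Cons s ts)
  have "foldr (\<circ>) ts id permutes A" by (rule foldr_permutes) (use Cons.prems in simp)
  then have "permutation (foldr (\<circ>) ts id)" using assms(1) permutation_permutes by blast
  moreover have "permutation s" using Cons.prems assms(1) permutation_permutes by auto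
  moreover have "foldr (\<circ>) (s # ts) id = s \<circ> foldr (\<circ>) ts id" by (simp only: foldr.simps comp_apply)
  ultimately have "sign (foldr (\<circ>) (s # ts) id) = sign s * sign (foldr (\<circ>) ts id)"
    by (simp only: sign_compose)
  also have "sign s = (-1) ^ (card A + ncyc A s)"
    using Cons.prems by (intro sign_eq_ncyc assms(1)) simp
  also have "sign (foldr (\<circ>) ts id) = (-1) ^ (length ts * card A + sum_list (map (ncyc A) ts))"
    by (rule Cons.IH) (use Cons.prems in simp)
  finally show ?case by (simp add: power_add algebra_simps)
qed

text \<open>Cyclic rotation of the relation moves \<phi> to the right end. Thus s is determined by
  the other entries, and its being a long cycle becomes a condition on their product.\<close>

lemma maps_SucD:
  assumes "(\<phi>, \<sigma>s) \<in> maps (Suc r) n \<mu>"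
  obtains s ts where "\<sigma>s = s # ts" "ts \<in> perm_lists {1..n} r" "s permutes {1..n}"
    "\<phi> permutes {1..n}" "ctype {1..n} \<phi> = \<mu>" "cyclic_on s {1..n}"
    "foldr (\<circ>) ts id \<circ> \<phi> = inv s"
proof -
  from assms have a: "length \<sigma>s = Suc r" "\<forall>\<sigma>\<in>set \<sigma>s. \<sigma> permutes {1..n}"
    "\<phi> \<circ> foldr (\<circ>) \<sigma>s id = id" "\<phi> permutes {1..n}" "ctype {1..n} \<phi> = \<mu>" "cyclic_on (\<sigma>s ! 0) {1..n}"
    by (auto simp: maps_def conj_class_def cycle_type_eq_ctype)
  then obtain s ts where s: "\<sigma>s = s # ts" "length ts = r" by (auto simp: length_Suc_conv)
  let ?T = "foldr (\<circ>) ts id"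
  have "foldr (\<circ>) \<sigma>s id = s \<circ> ?T" unfolding s by (simp only: foldr.simps comp_apply)
  then have 1: "\<phi> \<circ> (s \<circ> ?T) = id" using a(3) by (simp only:)
  have sp: "s permutes {1..n}" using a s by simp
  have "s \<circ> ?T = inv \<phi>"
    by (metis 1 a(4) comp_assoc comp_id id_comp permutes_inv_o(2))
  then have "(s \<circ> ?T) \<circ> \<phi> = id" using permutes_inv_o(2)[OF a(4)] by (simp only:)
  then have "?T \<circ> \<phi> = inv s"
    by (metis comp_assoc comp_id id_comp permutes_inv_o(2) sp)
  then show ?thesis using that a s sp by (auto simp: perm_lists_def)
qed

text \<open>The Riemann-Hurwitz formula: \<open>ncyc\<close> is subadditive up to \<open>n\<close>, and its parity is a sign.\<close>

lemma genus_maps: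
  assumes n: "n > 0" and M: "(\<phi>, s # ts) \<in> maps (Suc r) n \<mu>"
  shows "sum_list (map (ncyc {1..n}) ts) + size \<mu> + 2 * nat \<lfloor>genus (Suc r) n \<mu> (\<phi>, s # ts)\<rfloor>
    = r * n + 1"
proof -
  let ?A = "{1..n}" and ?T = "foldr (\<circ>) ts id"
  have fin: "finite ?A" by simp
  from M have ts: "ts \<in> perm_lists ?A r" and s: "s permutes ?A"
    and \<phi>: "\<phi> permutes ?A" "ctype ?A \<phi> = \<mu>" and cyc: "cyclic_on s ?A" and T: "?T \<circ> \<phi> = inv s"
    by (auto elim: maps_SucD)
  let ?S = "sum_list (map (ncyc ?A) ts)"
  have len: "length ts = r" and tsp: "\<forall>t\<in>set ts. t permutes ?A" using ts by (auto simp: perm_lists_def)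
  have Tp: "?T permutes ?A" using tsp by (rule foldr_permutes)
  have perms: "permutation s" "permutation ?T" "permutation \<phi>"
    using s Tp \<phi> fin permutation_permutes by blast+
  have s1: "ncyc ?A s = 1" using cyc cyclic_on_iff_ncyc[OF fin s] by simp
  have \<ell>: "ncyc ?A \<phi> = size \<mu>" using \<phi>(2) size_ctype[OF fin] by metis
  have "?S + n \<le> r * n + ncyc ?A ?T"
    using sum_list_ncyc_le[OF fin tsp] len by simp
  moreover have "ncyc ?A ?T + ncyc ?A \<phi> \<le> n + ncyc ?A (?T \<circ> \<phi>)"
    using ncyc_comp_ge[OF fin order_refl Tp \<phi>(1)] by simp
  ultimately have le: "?S + size \<mu> \<le> r * n + 1"
    unfolding T ncyc_inv[OF perms(1)] s1 \<ell> by simp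
  have "sign ?T * sign \<phi> = sign s"
    using T sign_compose[OF perms(2,3)] sign_inverse[OF perms(1)] by simp
  then have "(-1) ^ (r * n + ?S) * (-1) ^ (n + size \<mu>) = (-1 :: int) ^ (n + 1)"
    using sign_foldr[OF fin tsp] sign_eq_ncyc[OF fin \<phi>(1)] sign_eq_ncyc[OF fin s] s1 \<ell> len by simp
  then have "even (r * n + ?S + (n + size \<mu>)) \<longleftrightarrow> even (n + 1)"
    unfolding power_add[symmetric] by (simp only: minus_one_power_iff split: if_splits)
  \<comment> \<open>By \<open>le\<close> the truncated difference is exact, so it inherits the
    parity.\<close>
  then have "even (r * n + 1 - (?S + size \<mu>))" using le by auto
  then obtain \<gamma> where \<gamma>: "r * n + 1 - (?S + size \<mu>) = 2 * \<gamma>" by blast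
  have eq: "?S + size \<mu> + 2 * \<gamma> = r * n + 1" using \<gamma> le by linarith
  have "(\<Sum>i<Suc r. real (cyc n ((s # ts) ! i))) = 1 + (\<Sum>i<r. real (ncyc ?A (ts ! i)))"
    by (simp only: s1 of_nat_1 sum.lessThan_Suc_shift cyc_eq_ncyc nth_Cons_0 nth_Cons_Suc)
  also have "(\<Sum>i<r. real (ncyc ?A (ts ! i))) = real ?S"
    using len by (simp add: sum_list_sum_nth atLeast0LessThan)
  finally have "genus (Suc r) n \<mu> (\<phi>, s # ts) = 1 + (real r * real n - real (size \<mu>) - (1 + real ?S)) / 2"
    by (simp add: genus_def del: sum.lessThan_Suc)
  also have "\<dots> = real \<gamma>"
    using arg_cong[OF eq, of real] by (simp add: field_simps)
  finally show ?thesis using eq by simp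
qed

lemma sum_maps:
  fixes x :: complex
  assumes n: "n > 0"
  shows "(\<Sum>(\<phi>, \<sigma>s)\<in>maps (Suc r) n \<mu>. x ^ sum_list (map (ncyc {1..n}) (tl \<sigma>s)))
    = (\<Sum>\<phi>\<in>conj_class n \<mu>. \<Sum>ts | ts \<in> perm_lists {1..n} r \<and> cyclic_on (foldr (\<circ>) ts id \<circ> \<phi>) {1..n}.
        prod_list (map (\<lambda>s. x ^ ncyc {1..n} s) ts))"
proof -
  let ?A = "{1..n}"
  let ?L = "\<lambda>\<phi>. {ts. ts \<in> perm_lists ?A r \<and> cyclic_on (foldr (\<circ>) ts id \<circ> \<phi>) ?A}"
  have fC: "finite (conj_class n \<mu>)"
    by (rule finite_subset[OF _ finite_permutations[of ?A]]) (auto simp: conj_class_def)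
  have fL: "finite (?L \<phi>)" for \<phi> using finite_perm_lists[of ?A r] by simp
  have cyc_inv: "cyclic_on (inv p) ?A \<longleftrightarrow> cyclic_on p ?A" if "p permutes ?A" for p
  proof -
    have "permutation p" using that permutation_permutes by blast
    then show ?thesis
      by (simp only: cyclic_on_iff_ncyc[OF finite_atLeastAtMost] permutes_inv that ncyc_inv)
  qed
  have pw: "x ^ sum_list (map (ncyc ?A) ts) = prod_list (map (\<lambda>s. x ^ ncyc ?A s) ts)" for ts
    by (induction ts) (simp_all add: power_add)
  have "(\<Sum>(\<phi>, \<sigma>s)\<in>maps (Suc r) n \<mu>. x ^ sum_list (map (ncyc ?A) (tl \<sigma>s)))
    = (\<Sum>(\<phi>, ts)\<in>Sigma (conj_class n \<mu>) ?L. prod_list (map (\<lambda>s. x ^ ncyc ?A s) ts))"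
  proof (rule sum.reindex_bij_witness[where j = "\<lambda>(\<phi>, \<sigma>s). (\<phi>, tl \<sigma>s)"
        and i = "\<lambda>(\<phi>, ts). (\<phi>, inv (foldr (\<circ>) ts id \<circ> \<phi>) # ts)"], goal_cases)
    case (1 M)
    obtain \<phi> \<sigma>s where M: "M = (\<phi>, \<sigma>s)" by (cases M)
    with 1 obtain s ts where s: "\<sigma>s = s # ts" "s permutes ?A" "foldr (\<circ>) ts id \<circ> \<phi> = inv s"
      by (auto elim: maps_SucD)
    then show ?case by (simp only: M prod.case list.sel permutes_inv_inv[OF s(2)])
  next
    case (2 M)
    obtain \<phi> \<sigma>s where M: "M = (\<phi>, \<sigma>s)" by (cases M)
    from 2[unfolded M] obtain s ts where s: "\<sigma>s = s # ts" "ts \<in> perm_lists ?A r" "s permutes ?A"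
      "\<phi> permutes ?A" "ctype ?A \<phi> = \<mu>" "cyclic_on s ?A" "foldr (\<circ>) ts id \<circ> \<phi> = inv s"
      by (rule maps_SucD)
    have "cyclic_on (foldr (\<circ>) ts id \<circ> \<phi>) ?A"
      unfolding s(7) using s(6) cyc_inv[OF s(3)] by simp
    moreover have "\<phi> \<in> conj_class n \<mu>"
      using s by (simp add: conj_class_def cycle_type_eq_ctype)
    ultimately show ?case using s(1,2) by (simp only: M prod.case list.sel mem_Sigma_iff mem_Collect_eq simp_thms)
  next
    case (3 b)
    then show ?case by (auto split: prod.splits)
  next
    case (4 b)
    obtain \<phi> ts where b: "b = (\<phi>, ts)" by (cases b)
    let ?p = "foldr (\<circ>) ts id \<circ> \<phi>"
    have \<phi>: "\<phi> \<in> conj_class n \<mu>" "\<phi> permutes ?A" and ts: "length ts = r" "\<forall>t\<in>set ts. t permutes ?A"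
      and cyc: "cyclic_on ?p ?A"
      using 4 b by (auto simp: conj_class_def perm_lists_def)
    have p: "?p permutes ?A" using \<phi>(2) foldr_permutes[OF ts(2)] by (rule permutes_compose)
    have "foldr (\<circ>) (inv ?p # ts) id = inv ?p \<circ> foldr (\<circ>) ts id" by (simp only: foldr.simps comp_apply)
    moreover have "\<phi> \<circ> (inv ?p \<circ> foldr (\<circ>) ts id) = id"
    proof -
      have "(inv ?p \<circ> foldr (\<circ>) ts id) \<circ> \<phi> = id"
        using permutes_inv_o(2)[OF p] by (simp only: comp_assoc)
      then have "inv ?p \<circ> foldr (\<circ>) ts id = inv \<phi>"
        by (metis \<phi>(2) comp_assoc comp_id id_comp permutes_inv_o(1))
      then show ?thesis using permutes_inv_o(1)[OF \<phi>(2)] by (simp only:)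
    qed
    ultimately have "\<phi> \<circ> foldr (\<circ>) (inv ?p # ts) id = id" by (simp only:)
    then show ?case
      using \<phi>(1) ts p cyc cyc_inv[OF p] permutes_inv[OF p]
      by (simp only: b prod.case maps_def mem_Collect_eq length_Cons list.set ball_simps nth_Cons_0 simp_thms)
  next
    case (5 M)
    then show ?case by (cases M) (simp only: prod.case pw)
  qed
  also have "\<dots> = (\<Sum>\<phi>\<in>conj_class n \<mu>. \<Sum>ts\<in>?L \<phi>. prod_list (map (\<lambda>s. x ^ ncyc ?A s) ts))"
    using fC fL by (subst sum.Sigma) auto
  finally show ?thesis .
qed

lemma poly_Gamma_poly:
  "poly (map_poly complex_of_real (Gamma_poly m n \<mu>)) z
    = (\<Sum>M\<in>maps m n \<mu>. z ^ nat \<lfloor>genus m n \<mu> M\<rfloor>)"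
proof -
  have "map_poly complex_of_real (Gamma_poly m n \<mu>) = (\<Sum>M\<in>maps m n \<mu>. monom 1 (nat \<lfloor>genus m n \<mu> M\<rfloor>))"
    by (rule poly_eqI) (auto simp: Gamma_poly_def coeff_map_poly coeff_sum intro!: sum.cong)
  then show ?thesis by (simp add: poly_sum poly_monom)
qed

theorem theorem3p3:
  fixes n m :: nat and \<mu> :: "nat multiset" and z :: complex
  assumes "n > 0" and "m \<ge> 2" and "\<mu> \<turnstile> n"
    and "poly (map_poly complex_of_real (Gamma_poly m n \<mu>)) z = 0"
  shows "z \<in> \<real> \<and> Re z \<le> 0"
proof (cases "z = 0")
  case False
  let ?A = "{1..n}"
  \<comment> \<open>With \<open>x\<^sup>2 * z = 1\<close>, two cycles fewer in the tail weigh as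
    much as one more unit of genus.\<close>
  define x where "x = csqrt (inverse z)"
  have x2: "x\<^sup>2 * z = 1" using False by (simp add: x_def)
  then have x0: "x \<noteq> 0" by auto
  obtain r where r: "m = Suc r" "r > 0" using assms(2) by (cases m) auto
  obtain g where g: "cycle_poly \<mu> = [:1, -1:] * g" "degree g = n - 1" "g \<noteq> 0"
    "\<And>u. poly g u = 0 \<Longrightarrow> norm u = 1"
    using cycle_poly_quotient[OF assms(3,1)] by metis
  let ?C = "conj_class n \<mu>"
  have fC: "finite ?C"
    by (rule finite_subset[OF _ finite_permutations[of ?A]]) (auto simp: conj_class_def)
  have "?C \<noteq> {}"
    using ex_cycle_type[of ?A \<mu>] assms(3) by (auto simp: conj_class_def cycle_type_eq_ctype)
  let ?f = "\<lambda>y::complex. (\<Prod>i<n. y + of_nat i) ^ r"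
  have "{..<n} = {..degree g}" using g(2) assms(1) by auto
  then have shift: "(\<Sum>k<n. coeff g k * hook_content n k x ^ r) = shift_op g ?f x"
    unfolding shift_op_def using assms(1) g(2) by (intro sum.cong) (auto simp: hook_content_eq)
  have "(\<Sum>(\<phi>, \<sigma>s)\<in>maps m n \<mu>. x ^ sum_list (map (ncyc ?A) (tl \<sigma>s)))
    = (\<Sum>M\<in>maps m n \<mu>. x ^ (r * n + 1 - size \<mu>) * z ^ nat \<lfloor>genus m n \<mu> M\<rfloor>)"
  proof (intro sum.cong refl)
    fix M assume M: "M \<in> maps m n \<mu>"
    obtain \<phi> \<sigma>s where M': "M = (\<phi>, \<sigma>s)" by (cases M)
    with M r obtain s ts where s: "\<sigma>s = s # ts" by (auto elim: maps_SucD)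
    let ?\<gamma> = "nat \<lfloor>genus m n \<mu> M\<rfloor>"
    have "r * n + 1 - size \<mu> = sum_list (map (ncyc ?A) ts) + 2 * ?\<gamma>"
      using genus_maps[OF assms(1), of \<phi> s ts r \<mu>] M M' s r by simp
    then have "x ^ (r * n + 1 - size \<mu>) * z ^ ?\<gamma> = x ^ sum_list (map (ncyc ?A) ts) * (x\<^sup>2 * z) ^ ?\<gamma>"
      by (simp add: power_add power_mult power_mult_distrib)
    then show "(case M of (\<phi>, \<sigma>s) \<Rightarrow> x ^ sum_list (map (ncyc ?A) (tl \<sigma>s))) = x ^ (r * n + 1 - size \<mu>) * z ^ ?\<gamma>"
      by (simp add: M' s x2)
  qed
  also have "\<dots> = 0"
    using assms(4) unfolding poly_Gamma_poly by (simp flip: sum_distrib_left)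
  finally have "0 = of_nat n * (\<Sum>(\<phi>, \<sigma>s)\<in>maps m n \<mu>. x ^ sum_list (map (ncyc ?A) (tl \<sigma>s)))"
    by simp
  \<comment> \<open>A permutation enters only through its cycle type, by way of g, so all summands
    are equal.\<close>
  also have "\<dots> = (\<Sum>\<phi>\<in>?C. shift_op g ?f x)"
    unfolding r(1) sum_maps[OF assms(1)] sum_distrib_left
  proof (intro sum.cong refl)
    fix \<phi> assume "\<phi> \<in> ?C"
    then have "\<phi> permutes ?A" "ctype ?A \<phi> = \<mu>" by (auto simp: conj_class_def cycle_type_eq_ctype)
    then show "(\<Sum>ts | ts \<in> perm_lists ?A r \<and> cyclic_on (foldr (\<circ>) ts id \<circ> \<phi>) ?A.
        of_nat n * prod_list (map (\<lambda>s. x ^ ncyc ?A s) ts)) = shift_op g ?f x"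
      using sum_cyclic_products[of ?A \<phi> x g r] x0 g(1) assms(1) shift
      by (simp flip: sum_distrib_left)
  qed
  also have "\<dots> = of_nat (card ?C) * shift_op g ?f x" by simp
  finally have zero: "shift_op g ?f x = 0" using fC \<open>?C \<noteq> {}\<close> by simp
  have "degree g < n" using g(2) assms(1) by simp
  then obtain Q where Q: "\<And>z. poly Q z = 0 \<Longrightarrow> Re z = - (real (n - 1 - degree g)) / 2"
    "\<And>x. shift_op g ?f x = (\<Prod>i<n - degree g. x + of_nat i) ^ r * poly Q x"
    using shift_op_roots[OF g(3) _ g(4) r(2), of n] by metis
  \<comment> \<open>The only forced zero left is 0, which x is not; the remaining zeros have real
    part 0.\<close>
  have "n - degree g = 1" using g(2) assms(1) by simp
  then have "poly Q x = 0" using zero x0 unfolding Q(2) by simp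
  then have "Re x = 0" using Q(1)[of x] g(2) by simp
  then have "x\<^sup>2 = of_real (- (Im x)\<^sup>2)"
    by (simp add: complex_eq_iff power2_eq_square)
  then have "z = of_real (inverse (- (Im x)\<^sup>2))"
    using inverse_unique[OF x2] by simp
  then show ?thesis by simp
qed simp

end
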